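(* Let $q:\mathbb{R}^n\to\mathbb{R}\cup\{+\infty\}$ be proper, convex and lower semicontinuous. Then for every $(x,x^* )\in\mathrm{gph}\,\partial q$ there is a positive semidefinite $n\times n$ matrix $G$ with $\|G\|\le 1$ such that \[\{((I-G)v^*,\,Gv^* ) : v^*\in\mathbb{R}^n\}\subset \mathrm{gph}\, D^*(\partial q)(x,x^* ),\] i.e., $Gv^*\in D^*(\partial q)(x,x^* )((I-G)v^* )$ for every $v^*\in\mathbb{R}^n$.
   Context: $\partial q$ is the convex (Moreau–Rockafellar) subdifferential, viewed as a set-valued map $\mathbb{R}^n\rightrightarrows\mathbb{R}^n$; $\|G\|$ is the spectral norm. For a closed set $C$ and $\bar z\in C$: the regular normal cone $\widehat N_C(\bar z)$ is the polar of the tangent (contingent) cone $T_C(\bar z)=\{w:\exists t_k\downarrow0,w_k\to w,\ \bar z+t_kw_k\in C\}$, and the limiting normal cone $N_C(\bar z)$ consists of all limits $z^*=\lim z_k^*$ with $z_k^*\in\widehat N_C(z_k)$, $z_k\in C$, $z_k\to\bar z$. For a set-valued map $F$ with $(\bar x,\bar y)\in\mathrm{gph}\, F$, the limiting coderivative is $D^*F(\bar x,\bar y)(v^* )=\{u^*:(u^*,-v^* )\in N_{\mathrm{gph}\, F}(\bar x,\bar y)\}$, and $\mathrm{gph}\, D^*F(\bar x,\bar y)=\{(v^*,u^* ):u^*\in D^*F(\bar x,\bar y)(v^* )\}$. *)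

theory Defs
  imports "HOL-Analysis.Analysis"
begin

text \<open>Functions q : R^n -> R \<union> {+\<infinity>} are modelled as maps into ereal that never take -\<infinity>.\<close>

definition proper_fun :: "('a \<Rightarrow> ereal) \<Rightarrow> bool" where
  "proper_fun q \<longleftrightarrow> (\<forall>x. q x \<noteq> -\<infinity>) \<and> (\<exists>x. q x < \<infinity>)"

definition convex_efun :: "('a::real_vector \<Rightarrow> ereal) \<Rightarrow> bool" where
  "convex_efun q \<longleftrightarrow> (\<forall>x y (u::real). 0 < u \<and> u < 1 \<longrightarrow>
      q (u *\<^sub>R x + (1 - u) *\<^sub>R y) \<le> ereal u * q x + ereal (1 - u) * q y)"

definition lsc_fun :: "('a::topological_space \<Rightarrow> ereal) \<Rightarrow> bool" where
  "lsc_fun q \<longleftrightarrow> (\<forall>x. q x \<le> Liminf (at x) q)"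

definition subdiff :: "('a::real_inner \<Rightarrow> ereal) \<Rightarrow> 'a \<Rightarrow> 'a set" where
  "subdiff q x = {s. q x < \<infinity> \<and> (\<forall>y. q x + ereal (s \<bullet> (y - x)) \<le> q y)}"

definition graph :: "('a \<Rightarrow> 'b set) \<Rightarrow> ('a \<times> 'b) set" where
  "graph F = {(x, y). y \<in> F x}"

definition tangent_cone :: "'a::real_normed_vector set \<Rightarrow> 'a \<Rightarrow> 'a set" where
  "tangent_cone C z = {w. \<exists>(t::nat \<Rightarrow> real) wk. (\<forall>k. 0 < t k) \<and> t \<longlonglongrightarrow> 0 \<and>
      wk \<longlonglongrightarrow> w \<and> (\<forall>k. z + t k *\<^sub>R wk k \<in> C)}"

definition regular_normal_cone :: "'a::real_inner set \<Rightarrow> 'a \<Rightarrow> 'a set" where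
  "regular_normal_cone C z = {v. \<forall>w \<in> tangent_cone C z. v \<bullet> w \<le> 0}"

definition limiting_normal_cone :: "'a::real_inner set \<Rightarrow> 'a \<Rightarrow> 'a set" where
  "limiting_normal_cone C z = {v. \<exists>zk vk. (\<forall>k::nat. zk k \<in> C \<and> vk k \<in> regular_normal_cone C (zk k))
      \<and> zk \<longlonglongrightarrow> z \<and> vk \<longlonglongrightarrow> v}"

definition coderiv :: "('a::real_inner \<Rightarrow> 'b::real_inner set) \<Rightarrow> 'a \<times> 'b \<Rightarrow> 'b \<Rightarrow> 'a set" where
  "coderiv F xy v = {u. (u, - v) \<in> limiting_normal_cone (graph F) xy}"

definition psd_matrix :: "real ^'n ^'n \<Rightarrow> bool" where
  "psd_matrix G \<longleftrightarrow> transpose G = G \<and> (\<forall>v. 0 \<le> v \<bullet> (G *v v))"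

end

theory Submission
  imports Defs
begin

text \<open>The resolvent P of the subdifferential (P z is the unique p with z - p in the subdifferential
  at p) is firmly nonexpansive and the gradient of a convex function. It parametrizes the graph by
  z \<mapsto> (P z, z - P z). Where P has a derivative A, the matrix A is symmetric with |Av|^2 \<le> v \<bullet> Av,
  the tangent vectors of the graph are (Aw, (I-A)w), and hence all ((I-A)v, -Av) are regular normals.
  By Rademacher's theorem such points z are dense, the matrices A are bounded there, and a limit B
  of them along points tending to x + x* yields G = I - B.

  Rademacher's theorem itself: in dimension one, the set of points where the difference quotients
  are infinitely often below p and infinitely often above q > p is null, since its image under an
  increasing function has measure at most p and at least q times its own measure. Fubini gives
  directional derivatives almost everywhere, and these are combined into a derivative at points where
  a set of approximately constant directional derivative is not porous.\<close>

subsection \<open>Differentiability almost everywhere of Lipschitz functions\<close>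

text \<open>Vitali's theorem covers almost all of \<open>T\<close> by disjoint balls inside an open
  \<open>U\<close> around \<open>S\<close> with \<open>U - S\<close> small. Each ball contains a
  hole of comparable volume, and the holes lie disjointly in \<open>U - S\<close>, so the balls have
  small total measure too.\<close>

lemma negligible_porous:
  fixes S :: "'a::euclidean_space set"
  assumes S: "S \<in> sets lebesgue" and "0 < \<epsilon>" "\<epsilon> \<le> 1"
    and porous: "\<And>x d. x \<in> T \<Longrightarrow> 0 < d \<Longrightarrow> \<exists>y. y \<noteq> x \<and> dist x y < d \<and> ball y (\<epsilon> * dist x y) \<inter> S = {}"
    and "T \<subseteq> S"
  shows "negligible T"
proof -
  \<comment> \<open>The volume ratio of a ball of radius \<open>2 * dist x y\<close> to a hole of
    radius \<open>\<epsilon> * dist x y\<close>.\<close>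
  define M where "M = (2 / \<epsilon>) ^ DIM('a)"
  have M0: "M > 0" using \<open>0 < \<epsilon>\<close> by (simp add: M_def)
  have "\<exists>V. T \<subseteq> V \<and> V \<in> lmeasurable \<and> measure lebesgue V \<le> e" if "e > 0" for e :: real
  proof -
    from M0 \<open>e > 0\<close> have eM: "e / M > 0" by simp
    obtain U where U: "open U" "S \<subseteq> U" "U - S \<in> lmeasurable" "emeasure lebesgue (U - S) < ennreal (e / M)"
      using sets_lebesgue_outer_open[OF S eM] .
    \<comment> \<open>The factor 2 leaves room for the hole at \<open>y\<close> inside the ball at
      \<open>x\<close>, since \<open>\<epsilon> \<le> 1\<close>.\<close>
    define K where "K = {(x, y). y \<noteq> x \<and> cball x (2 * dist x y) \<subseteq> U \<and> ball y (\<epsilon> * dist x y) \<inter> S = {}}"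
    have K0: "0 < 2 * dist (fst i) (snd i)" if "i \<in> K" for i
      using that by (auto simp: K_def)
    have cov: "\<exists>i. i \<in> K \<and> x \<in> cball (fst i) (2 * dist (fst i) (snd i)) \<and> 2 * dist (fst i) (snd i) < d"
      if "x \<in> T" "0 < d" for x d
    proof -
      obtain r where r: "r > 0" "cball x r \<subseteq> U"
        using U \<open>x \<in> T\<close> \<open>T \<subseteq> S\<close> by (meson in_mono open_contains_cball)
      obtain y where y: "y \<noteq> x" "dist x y < min d r / 2" "ball y (\<epsilon> * dist x y) \<inter> S = {}"
        using porous[OF \<open>x \<in> T\<close>, of "min d r / 2"] r \<open>0 < d\<close> by auto
      have "(x, y) \<in> K"
        using y r by (auto simp: K_def intro: order_trans[OF subset_cball[of _ r]])
      then show ?thesis using y by (intro exI[of _ "(x, y)"]) auto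
    qed
    obtain C where C: "countable C" "C \<subseteq> K"
      "pairwise (\<lambda>i j. disjnt (cball (fst i) (2 * dist (fst i) (snd i))) (cball (fst j) (2 * dist (fst j) (snd j)))) C"
      "negligible (T - (\<Union>i\<in>C. cball (fst i) (2 * dist (fst i) (snd i))))"
      by (rule Vitali_covering_theorem_cballs[of K "\<lambda>i. 2 * dist (fst i) (snd i)" T fst, OF K0 cov])
    define B where "B i = cball (fst i) (2 * dist (fst i) (snd i))" for i :: "'a \<times> 'a"
    define D where "D i = ball (snd i) (\<epsilon> * dist (fst i) (snd i))" for i :: "'a \<times> 'a"
    have sets [simp]: "B i \<in> sets lebesgue" "D i \<in> sets lebesgue" for i
      by (simp_all add: B_def D_def)
    have DB: "D i \<subseteq> B i" for i
    proof
      fix u assume "u \<in> D i"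
      then have "dist (snd i) u < dist (fst i) (snd i)"
        using mult_right_mono[OF \<open>\<epsilon> \<le> 1\<close>, of "dist (fst i) (snd i)"] by (auto simp: D_def)
      then show "u \<in> B i"
        using dist_triangle[of "fst i" u "snd i"] by (auto simp: B_def)
    qed
    have disB: "disjoint_family_on B C"
      using C(3) by (auto simp: disjoint_family_on_def pairwise_def disjnt_def B_def)
    then have disD: "disjoint_family_on D C"
      using DB by (fastforce simp: disjoint_family_on_def)
    have DU: "(\<Union>i\<in>C. D i) \<subseteq> U - S"
    proof -
      have "D i \<subseteq> U - S" if "i \<in> C" for i
        using that C(2) DB[of i] by (fastforce simp: K_def D_def B_def)
      then show ?thesis by auto
    qed
    have MB: "emeasure lebesgue (B i) \<le> ennreal M * emeasure lebesgue (D i)" for i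
    proof -
      have "emeasure lborel (B i) = ennreal (unit_ball_vol DIM('a) * (2 * dist (fst i) (snd i)) ^ DIM('a))"
        by (simp add: B_def emeasure_cball)
      also have "\<dots> = ennreal (M * (unit_ball_vol DIM('a) * (\<epsilon> * dist (fst i) (snd i)) ^ DIM('a)))"
        using \<open>0 < \<epsilon>\<close> by (simp add: M_def power_mult_distrib power_divide)
      also have "\<dots> = ennreal M * emeasure lborel (D i)"
        using \<open>0 < \<epsilon>\<close> M0 by (simp add: D_def emeasure_ball ennreal_mult')
      finally show ?thesis by (simp add: B_def D_def)
    qed
    have "emeasure lebesgue (\<Union>i\<in>C. B i) = (\<integral>\<^sup>+i. emeasure lebesgue (B i) \<partial>count_space C)"
      using C(1) disB by (intro emeasure_UN_countable) auto
    also have "\<dots> \<le> (\<integral>\<^sup>+i. ennreal M * emeasure lebesgue (D i) \<partial>count_space C)"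
      by (intro nn_integral_mono MB)
    also have "\<dots> = ennreal M * (\<integral>\<^sup>+i. emeasure lebesgue (D i) \<partial>count_space C)"
      by (simp add: nn_integral_cmult)
    also have "(\<integral>\<^sup>+i. emeasure lebesgue (D i) \<partial>count_space C) = emeasure lebesgue (\<Union>i\<in>C. D i)"
      using C(1) disD by (intro emeasure_UN_countable[symmetric]) auto
    also have "\<dots> \<le> emeasure lebesgue (U - S)"
      using U(3) by (intro emeasure_mono DU) auto
    also have "\<dots> \<le> ennreal (e / M)" using U(4) by simp
    also have "ennreal M * ennreal (e / M) = ennreal e"
      using M0 \<open>e > 0\<close> by (simp flip: ennreal_mult')
    finally have le: "emeasure lebesgue (\<Union>i\<in>C. B i) \<le> ennreal e" by (simp add: mult_left_mono)
    have sB: "(\<Union>i\<in>C. B i) \<in> sets lebesgue"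
      using C(1) by (intro sets.countable_UN') auto
    let ?N = "T - (\<Union>i\<in>C. B i)"
    have N: "?N \<in> null_sets lebesgue"
      using C(4) by (simp add: B_def negligible_iff_null_sets)
    have eq: "emeasure lebesgue ((\<Union>i\<in>C. B i) \<union> ?N) = emeasure lebesgue (\<Union>i\<in>C. B i)"
      using sB N by (rule emeasure_Un_null_set)
    have fm: "(\<Union>i\<in>C. B i) \<union> ?N \<in> lmeasurable"
      using sB null_setsD2[OF N] le eq
      by (intro fmeasurableI sets.Un) (simp_all only: le_less_trans[OF _ ennreal_less_top] infinity_ennreal_def)
    have "measure lebesgue ((\<Union>i\<in>C. B i) \<union> ?N) \<le> e"
      using le eq \<open>e > 0\<close> by (simp add: measure_def enn2real_leI)
    then show ?thesis using fm by (intro exI[of _ "(\<Union>i\<in>C. B i) \<union> ?N"]) auto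
  qed
  then show ?thesis by (auto simp: negligible_outer_le)
qed

text \<open>Vitali's theorem picks disjoint intervals of slope at most \<open>p\<close> inside an
  open set barely larger than \<open>E\<close>. Monotonicity keeps their images disjoint, so the
  lengths of the images add up to at most \<open>p\<close> times the measure of the open set. The
  uncovered null set has a null image because \<open>g\<close> is Lipschitz.\<close>

lemma emeasure_image_le_slope:
  fixes g :: "real \<Rightarrow> real"
  assumes E: "E \<in> sets lebesgue" and "strict_mono g" and lip: "L-lipschitz_on UNIV g" and "0 \<le> p"
    and slope: "\<And>x d. x \<in> E \<Longrightarrow> 0 < d \<Longrightarrow> \<exists>a b. a \<le> x \<and> x \<le> b \<and> a < b \<and> b - a < d \<and> g b - g a \<le> p * (b - a)"
  shows "emeasure lebesgue (g ` E) \<le> ennreal p * emeasure lebesgue E"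
proof -
  have "emeasure lebesgue (g ` E) \<le> ennreal p * (emeasure lebesgue E + ennreal e)" if "e > 0" for e :: real
  proof -
    obtain U where U: "open U" "E \<subseteq> U" "U - E \<in> lmeasurable" "emeasure lebesgue (U - E) < ennreal e"
      using sets_lebesgue_outer_open[OF E \<open>e > 0\<close>] .
    define K where "K = {(c, r). 0 < r \<and> cball c r \<subseteq> U \<and> g (c + r) - g (c - r) \<le> p * (2 * r)}"
    have K0: "0 < snd i" if "i \<in> K" for i
      using that by (auto simp: K_def)
    have cov: "\<exists>i. i \<in> K \<and> x \<in> cball (fst i) (snd i) \<and> snd i < d" if "x \<in> E" "0 < d" for x d
    proof -
      obtain r where r: "r > 0" "cball x r \<subseteq> U"
        using U \<open>x \<in> E\<close> by (meson in_mono open_contains_cball)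
      obtain a b where ab: "a \<le> x" "x \<le> b" "a < b" "b - a < min d r" "g b - g a \<le> p * (b - a)"
        using slope[OF \<open>x \<in> E\<close>, of "min d r"] r \<open>0 < d\<close> by auto
      \<comment> \<open>A ball in the line is an interval about its midpoint, so \<open>x\<close> is
        merely a point of the ball, not its center.\<close>
      have cb: "cball ((a + b) / 2) ((b - a) / 2) = {a..b}"
        by (auto simp: cball_eq_atLeastAtMost field_simps)
      have "{a..b} \<subseteq> cball x r"
        using ab by (auto simp: dist_real_def)
      then have "((a + b) / 2, (b - a) / 2) \<in> K"
        using ab r cb by (auto simp: K_def field_simps)
      then show ?thesis using ab cb by (intro exI[of _ "((a + b) / 2, (b - a) / 2)"]) auto
    qed
    obtain C where C: "countable C" "C \<subseteq> K"
      "pairwise (\<lambda>i j. disjnt (cball (fst i) (snd i)) (cball (fst j) (snd j))) C"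
      "negligible (E - (\<Union>i\<in>C. cball (fst i) (snd i)))"
      by (rule Vitali_covering_theorem_cballs[of K snd E fst, OF K0 cov])
    define B where "B i = cball (fst i) (snd i)" for i :: "real \<times> real"
    define D where "D i = {g (fst i - snd i)..g (fst i + snd i)}" for i :: "real \<times> real"
    have sets [simp]: "B i \<in> sets lebesgue" "D i \<in> sets lebesgue" for i
      by (simp_all add: B_def D_def)
    have disB: "disjoint_family_on B C"
      using C(3) by (auto simp: disjoint_family_on_def pairwise_def disjnt_def B_def)
    have disD: "disjoint_family_on D C"
      unfolding disjoint_family_on_def
    proof (intro ballI impI)
      fix i j assume ij: "i \<in> C" "j \<in> C" "i \<noteq> j"
      then have "B i \<inter> B j = {}" using disB by (auto simp: disjoint_family_on_def)
      moreover have "snd i > 0" "snd j > 0" using ij C(2) K0 by blast+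
      ultimately have "fst i + snd i < fst j - snd j \<or> fst j + snd j < fst i - snd i"
        by (auto simp: B_def cball_eq_atLeastAtMost)
      then have "g (fst i + snd i) < g (fst j - snd j) \<or> g (fst j + snd j) < g (fst i - snd i)"
        using \<open>strict_mono g\<close> by (meson strict_monoD)
      then show "D i \<inter> D j = {}" by (auto simp: D_def)
    qed
    have DB: "emeasure lebesgue (D i) \<le> ennreal p * emeasure lebesgue (B i)" if "i \<in> C" for i
    proof -
      have "i \<in> K" using that C(2) by blast
      then have i: "snd i > 0" "g (fst i + snd i) - g (fst i - snd i) \<le> p * (2 * snd i)"
        by (simp_all add: K_def case_prod_beta)
      then have "g (fst i - snd i) < g (fst i + snd i)"
        by (intro strict_monoD[OF \<open>strict_mono g\<close>]) simp
      then have "emeasure lborel (D i) = ennreal (g (fst i + snd i) - g (fst i - snd i))"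
        by (simp add: D_def)
      also have "\<dots> \<le> ennreal (p * (2 * snd i))"
        using i by (intro ennreal_leI)
      also have "\<dots> = ennreal p * emeasure lborel (B i)"
        using i \<open>0 \<le> p\<close> by (simp add: B_def cball_eq_atLeastAtMost ennreal_mult)
      finally show ?thesis by (simp add: B_def D_def)
    qed
    have "B i \<subseteq> U" if "i \<in> K" for i
      using that by (simp add: K_def B_def case_prod_beta)
    then have BU: "(\<Union>i\<in>C. B i) \<subseteq> U"
      using C(2) by blast
    have "norm (g y - g x) \<le> L * norm (y - x)" for x y
      using lipschitz_onD[OF lip, of y x] by (simp add: dist_norm)
    then have "negligible (g ` (E - (\<Union>i\<in>C. B i)))"
      using C(4)
      by (intro negligible_locally_Lipschitz_image exI[of _ UNIV] exI[of _ L]) (simp_all add: B_def)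
    then have N: "g ` (E - (\<Union>i\<in>C. B i)) \<in> null_sets lebesgue"
      by (simp add: negligible_iff_null_sets)
    have sD: "(\<Union>i\<in>C. D i) \<in> sets lebesgue"
      using C(1) by (intro sets.countable_UN') auto
    have "g x \<in> (\<Union>i\<in>C. D i)" if "x \<in> (\<Union>i\<in>C. B i)" for x
      using that \<open>strict_mono g\<close> by (auto simp: B_def D_def cball_eq_atLeastAtMost strict_mono_less_eq)
    then have "g ` E \<subseteq> (\<Union>i\<in>C. D i) \<union> g ` (E - (\<Union>i\<in>C. B i))" by blast
    then have "emeasure lebesgue (g ` E) \<le> emeasure lebesgue ((\<Union>i\<in>C. D i) \<union> g ` (E - (\<Union>i\<in>C. B i)))"
      using sD N by (intro emeasure_mono) auto
    also have "\<dots> = emeasure lebesgue (\<Union>i\<in>C. D i)"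
      using sD N by (rule emeasure_Un_null_set)
    also have "\<dots> = (\<integral>\<^sup>+i. emeasure lebesgue (D i) \<partial>count_space C)"
      using C(1) disD by (intro emeasure_UN_countable) auto
    also have "\<dots> \<le> (\<integral>\<^sup>+i. ennreal p * emeasure lebesgue (B i) \<partial>count_space C)"
      using DB by (intro nn_integral_mono) auto
    also have "\<dots> = ennreal p * (\<integral>\<^sup>+i. emeasure lebesgue (B i) \<partial>count_space C)"
      by (simp add: nn_integral_cmult)
    also have "(\<integral>\<^sup>+i. emeasure lebesgue (B i) \<partial>count_space C) = emeasure lebesgue (\<Union>i\<in>C. B i)"
      using C(1) disB by (intro emeasure_UN_countable[symmetric]) auto
    also have "\<dots> \<le> emeasure lebesgue (E \<union> (U - E))"
      using BU E U by (intro emeasure_mono) auto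
    also have "\<dots> \<le> emeasure lebesgue E + emeasure lebesgue (U - E)"
      using E U by (intro emeasure_subadditive) auto
    also have "\<dots> \<le> emeasure lebesgue E + ennreal e"
      using U by (intro add_left_mono) auto
    finally show ?thesis by (simp add: mult_left_mono)
  qed
  \<comment> \<open>Replacing \<open>e\<close> by \<open>e / p\<close> turns the error
    \<open>p * e\<close> into \<open>e\<close> if \<open>p > 0\<close>. For \<open>p = 0\<close> the
    right-hand side with \<open>e = 1\<close> is already 0.\<close>
  note * = this
  show ?thesis
  proof (cases "p = 0")
    case True then show ?thesis using *[of 1] by simp
  next
    case False
    then have p: "p > 0" using \<open>0 \<le> p\<close> by simp
    show ?thesis
    proof (rule ennreal_le_epsilon)
      fix e :: real assume "e > 0"
      then have "emeasure lebesgue (g ` E) \<le> ennreal p * (emeasure lebesgue E + ennreal (e / p))"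
        using p by (intro *) auto
      also have "\<dots> = ennreal p * emeasure lebesgue E + ennreal e"
        using p \<open>e > 0\<close> by (simp add: distrib_left flip: ennreal_mult)
      finally show "emeasure lebesgue (g ` E) \<le> ennreal p * emeasure lebesgue E + ennreal e" .
    qed
  qed
qed

section \<open>Points where difference quotients oscillate between two levels\<close>

definition oscillation_set :: "('a::real_normed_vector \<Rightarrow> real) \<Rightarrow> 'a \<Rightarrow> real \<Rightarrow> real \<Rightarrow> 'a set" where
  "oscillation_set g e p q = {x.
     (\<forall>d>0. \<exists>t. t \<noteq> 0 \<and> \<bar>t\<bar> < d \<and> (g (x + t *\<^sub>R e) - g x) / t < p) \<and>
     (\<forall>d>0. \<exists>t. t \<noteq> 0 \<and> \<bar>t\<bar> < d \<and> q < (g (x + t *\<^sub>R e) - g x) / t)}"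

text \<open>It suffices to let \<open>d\<close> run through \<open>inverse (real (Suc n))\<close>,
  and the union over uncountably many \<open>t\<close> is still open, so the set is a countable
  intersection of open sets.\<close>

lemma borel_recurrent_open:
  fixes W :: "real \<Rightarrow> 'a::topological_space set"
  assumes "\<And>t. open (W t)"
  shows "{x. \<forall>d>0. \<exists>t. t \<noteq> 0 \<and> \<bar>t\<bar> < d \<and> x \<in> W t} \<in> sets borel"
proof -
  have "{x. \<forall>d>0. \<exists>t. t \<noteq> 0 \<and> \<bar>t\<bar> < d \<and> x \<in> W t}
      = (\<Inter>n. \<Union>t\<in>{t. t \<noteq> 0 \<and> \<bar>t\<bar> < inverse (real (Suc n))}. W t)" (is "?A = ?B")
  proof
    show "?A \<subseteq> ?B" 
    proof
      fix x assume x: "x \<in> ?A"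
      show "x \<in> ?B"
      proof
        fix n
        have "inverse (real (Suc n)) > 0" by simp
        then obtain t where "t \<noteq> 0 \<and> \<bar>t\<bar> < inverse (real (Suc n)) \<and> x \<in> W t" using x by blast
        then show "x \<in> (\<Union>t\<in>{t. t \<noteq> 0 \<and> \<bar>t\<bar> < inverse (real (Suc n))}. W t)" by blast
      qed
    qed
    show "?B \<subseteq> ?A"
    proof (intro subsetI CollectI allI impI)
      fix x and d :: real assume x: "x \<in> ?B" and "d > 0"
      obtain n where "inverse (real (Suc n)) < d" using reals_Archimedean[OF \<open>d > 0\<close>] by blast
      moreover obtain t where "t \<noteq> 0" "\<bar>t\<bar> < inverse (real (Suc n))" "x \<in> W t" using x by blast
      ultimately show "\<exists>t. t \<noteq> 0 \<and> \<bar>t\<bar> < d \<and> x \<in> W t" by force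
    qed
  qed
  also have "\<dots> \<in> sets borel"
    using assms by (intro sets.countable_INT image_subsetI borel_open open_UN ballI) simp_all
  finally show ?thesis .
qed

lemma borel_oscillation_set:
  assumes "continuous_on UNIV g"
  shows "oscillation_set g e p q \<in> sets borel"
proof -
  have [continuous_intros]: "continuous_on UNIV (\<lambda>x. g (x + t *\<^sub>R e))" for t
    by (rule continuous_on_compose2[OF assms]) (auto intro!: continuous_intros)
  have "continuous_on UNIV (\<lambda>x. (g (x + t *\<^sub>R e) - g x) / t)" for t
    using assms by (cases "t = 0") (auto intro!: continuous_intros)
  then have o: "open {x. (g (x + t *\<^sub>R e) - g x) / t < p}" "open {x. q < (g (x + t *\<^sub>R e) - g x) / t}" for t
    by (intro open_Collect_less continuous_on_const; simp)+
  have "oscillation_set g e p q =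
      {x. \<forall>d>0. \<exists>t. t \<noteq> 0 \<and> \<bar>t\<bar> < d \<and> x \<in> {x. (g (x + t *\<^sub>R e) - g x) / t < p}} \<inter>
      {x. \<forall>d>0. \<exists>t. t \<noteq> 0 \<and> \<bar>t\<bar> < d \<and> x \<in> {x. q < (g (x + t *\<^sub>R e) - g x) / t}}"
    by (auto simp: oscillation_set_def)
  also have "\<dots> \<in> sets borel"
    by (intro sets.Int borel_recurrent_open o)
  finally show ?thesis .
qed

text \<open>After a linear term is added, \<open>g\<close> becomes an increasing bi-Lipschitz
  \<open>G\<close>. By the slope estimate the image of a bounded piece \<open>E\<close> has at most
  \<open>P\<close> times the measure of \<open>E\<close>; by the same estimate for the inverse
  \<open>H\<close> it has at least \<open>Q\<close> times that measure. As \<open>P < Q\<close>, the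
  piece is null.\<close>

lemma negligible_oscillation_set_real:
  fixes g :: "real \<Rightarrow> real"
  assumes lip: "L-lipschitz_on UNIV g" and "p < q"
  shows "negligible (oscillation_set g 1 p q)"
proof -
  \<comment> \<open>The excess 1 over the Lipschitz constant gives \<open>G\<close> slope at least
    1, hence surjectivity and a 1-Lipschitz inverse. \<open>P\<close> and \<open>Q\<close> are
    \<open>p\<close> and \<open>q\<close> after the shift of all slopes by
    \<open>L + 1\<close>.\<close>
  define G where "G x = g x + (L + 1) * x" for x
  define P Q where "P = p + L + 1" and "Q = q + L + 1"
  have L0: "L \<ge> 0" using lip by (rule lipschitz_on_nonneg)
  have gL: "\<bar>g x - g y\<bar> \<le> L * \<bar>x - y\<bar>" for x y
    using lipschitz_onD[OF lip, of x y] by (simp add: dist_real_def)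
  have Glow: "y - x \<le> G y - G x" and Gup: "G y - G x \<le> (2 * L + 1) * (y - x)" if "x \<le> y" for x y
    using gL[of x y] that by (auto simp: G_def algebra_simps abs_if split: if_splits)
  have Gmono: "strict_mono G"
  proof (rule strict_monoI)
    fix x y :: real assume "x < y" then show "G x < G y" using Glow[of x y] by simp
  qed
  have Glip: "(2 * L + 1)-lipschitz_on UNIV G"
  proof (rule lipschitz_on_leI)
    fix x y :: real assume "x \<le> y"
    then show "dist (G x) (G y) \<le> (2 * L + 1) * dist x y"
      using Glow[of x y] Gup[of x y] by (simp add: dist_real_def)
  qed (use L0 in auto)
  have "\<exists>x. G x = y" for y
  proof -
    define b where "b = \<bar>y - G 0\<bar>"
    have "G (- b) \<le> y" "y \<le> G b" "- b \<le> b"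
      using Glow[of 0 b] Glow[of "- b" 0] by (auto simp: b_def)
    moreover have "continuous_on {- b..b} G"
      using lipschitz_on_continuous_on[OF Glip] continuous_on_subset by blast
    ultimately show ?thesis using IVT'[of G "- b" y b] by blast
  qed
  then have "bij G" using strict_mono_imp_inj_on[OF Gmono] by (metis bijI surjI)
  define H where "H = inv G"
  have HG: "H (G x) = x" and GH: "G (H y) = y" for x y
    using \<open>bij G\<close> by (auto simp: H_def bij_is_inj bij_is_surj surj_f_inv_f)
  have Hmono: "strict_mono H"
  proof (rule strict_monoI)
    fix x y :: real assume "x < y"
    then have "G (H x) < G (H y)" by (simp add: GH)
    then show "H x < H y" using Gmono by (simp add: strict_mono_less)
  qed
  have Hlip: "1-lipschitz_on UNIV H"
  proof (rule lipschitz_on_leI)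
    fix x y :: real assume "x \<le> y"
    then have "H x \<le> H y" using Hmono by (simp add: strict_mono_less_eq)
    then show "dist (H x) (H y) \<le> 1 * dist x y"
      using Glow[of "H x" "H y"] \<open>x \<le> y\<close> by (simp add: dist_real_def GH)
  qed auto
  \<comment> \<open>The cut to a bounded interval makes the measure finite, so that it can be
    cancelled at the end.\<close>
  have "negligible (oscillation_set g 1 p q \<inter> {- R..R})" for R
  proof (cases "oscillation_set g 1 p q \<inter> {- R..R} = {}")
    case False
    define E where "E = oscillation_set g 1 p q \<inter> {- R..R}"
    have below: "\<exists>a b. a \<le> x \<and> x \<le> b \<and> a < b \<and> b - a < d \<and> G b - G a < P * (b - a)"
      if "x \<in> E" "d > 0" for x d
    proof -
      obtain t where t: "t \<noteq> 0" "\<bar>t\<bar> < d" "(g (x + t) - g x) / t < p"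
        using \<open>x \<in> E\<close> \<open>d > 0\<close> by (auto simp: E_def oscillation_set_def)
      then show ?thesis
        by (intro exI[of _ "min x (x + t)"] exI[of _ "max x (x + t)"])
           (auto simp: min_def max_def G_def P_def field_simps split: if_splits)
    qed
    have above: "\<exists>a b. a \<le> x \<and> x \<le> b \<and> a < b \<and> b - a < d \<and> Q * (b - a) < G b - G a"
      if "x \<in> E" "d > 0" for x d
    proof -
      obtain t where t: "t \<noteq> 0" "\<bar>t\<bar> < d" "q < (g (x + t) - g x) / t"
        using \<open>x \<in> E\<close> \<open>d > 0\<close> by (auto simp: E_def oscillation_set_def)
      then show ?thesis
        by (intro exI[of _ "min x (x + t)"] exI[of _ "max x (x + t)"])
           (auto simp: min_def max_def G_def Q_def field_simps split: if_splits)
    qed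
    \<comment> \<open>Some slope of \<open>G\<close> is below \<open>P\<close>, while all its slopes
      are at least 1.\<close>
    have "P > 0"
    proof -
      obtain x where "x \<in> E" using False unfolding E_def by blast
      then obtain a b where "a < b" "G b - G a < P * (b - a)" using below[of x 1] by auto
      then have "(b - a) * 1 < (b - a) * P" using Glow[of a b] by (simp add: algebra_simps)
      then have "1 < P" using \<open>a < b\<close> by (simp only: mult_less_cancel_left_pos diff_gt_0_iff_gt)
      then show ?thesis by simp
    qed
    moreover have "P < Q" using \<open>p < q\<close> by (simp add: P_def Q_def)
    ultimately have "Q > 0" by simp
    have Eb: "E \<in> sets borel"
      using borel_oscillation_set[OF lipschitz_on_continuous_on[OF lip]] by (simp add: E_def)
    have "G ` E = H -` E"
      by (auto simp: HG) (metis GH imageI)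
    moreover have "H \<in> borel_measurable borel"
      by (intro borel_measurable_continuous_onI lipschitz_on_continuous_on[OF Hlip])
    ultimately have GEb: "G ` E \<in> sets borel"
      using Eb measurable_sets[of H borel borel E] by simp
    have 1: "emeasure lebesgue (G ` E) \<le> ennreal P * emeasure lebesgue E"
      using below Eb \<open>P > 0\<close>
      by (intro emeasure_image_le_slope[OF _ Gmono Glip]) (auto intro: less_imp_le, meson less_imp_le)
    have "emeasure lebesgue (H ` G ` E) \<le> ennreal (1 / Q) * emeasure lebesgue (G ` E)"
    proof (intro emeasure_image_le_slope[OF _ Hmono Hlip])
      fix y d :: real assume "y \<in> G ` E" and "0 < d"
      then obtain x where x: "x \<in> E" "y = G x" by blast
      \<comment> \<open>\<open>G\<close> stretches lengths by at most \<open>2 * L + 1\<close>, so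
        the image of an interval this short is shorter than \<open>d\<close>.\<close>
      have "d / (2 * L + 1) > 0" using \<open>0 < d\<close> L0 by simp
      then obtain a b where ab: "a \<le> x" "x \<le> b" "a < b" "b - a < d / (2 * L + 1)" "Q * (b - a) < G b - G a"
        using above[OF x(1)] by blast
      have "(2 * L + 1) * (b - a) < d" using ab(4) L0 by (simp add: field_simps)
      then have "G b - G a < d" using Gup[of a b] ab by linarith
      moreover have "G a \<le> y" "y \<le> G b" "G a < G b"
        using ab x Gmono by (auto simp: strict_mono_less_eq strict_mono_less)
      moreover have "H (G b) - H (G a) \<le> 1 / Q * (G b - G a)"
        using ab(5) \<open>Q > 0\<close> by (simp add: HG field_simps)
      ultimately show "\<exists>a b. a \<le> y \<and> y \<le> b \<and> a < b \<and> b - a < d \<and> H b - H a \<le> 1 / Q * (b - a)"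
        by blast
    qed (use GEb \<open>Q > 0\<close> in auto)
    also have "\<dots> \<le> ennreal (1 / Q) * (ennreal P * emeasure lebesgue E)"
      using 1 by (rule mult_left_mono) simp
    also have "\<dots> = ennreal (P / Q) * emeasure lebesgue E"
      using \<open>P > 0\<close> \<open>Q > 0\<close> by (simp add: mult.assoc[symmetric] ennreal_mult[symmetric])
    also have "H ` G ` E = E" by (simp add: image_image HG)
    finally have le: "emeasure lebesgue E \<le> ennreal (P / Q) * emeasure lebesgue E" .
    have "bounded E"
      using bounded_subset[OF bounded_closed_interval[of "- R" R]] by (simp add: E_def)
    then have Elm: "E \<in> lmeasurable"
      using Eb by (intro bounded_set_imp_lmeasurable) simp_all
    define m where "m = measure lebesgue E"
    have m: "m \<ge> 0" "emeasure lebesgue E = ennreal m"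
      using emeasure_eq_measure2[OF Elm] by (simp_all add: m_def)
    then have "m \<le> P / Q * m"
      using le \<open>P > 0\<close> \<open>Q > 0\<close> by (simp flip: ennreal_mult)
    moreover have "P / Q < 1" using \<open>P < Q\<close> \<open>Q > 0\<close> by simp
    ultimately have "m = 0"
      using m(1) mult_strict_right_mono[of "P / Q" 1 m] by (cases "m = 0") auto
    then show ?thesis using m Elm
      by (simp add: negligible_iff_null_sets null_sets_def E_def[symmetric] fmeasurableD)
  qed simp
  then have "negligible (\<Union>n. oscillation_set g 1 p q \<inter> {- real n..real n})"
    by (intro negligible_countable_Union) auto
  moreover have "oscillation_set g 1 p q \<subseteq> (\<Union>n. oscillation_set g 1 p q \<inter> {- real n..real n})"
  proof
    fix x assume "x \<in> oscillation_set g 1 p q"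
    moreover obtain n where "\<bar>x\<bar> \<le> real n" using real_arch_simple by blast
    ultimately show "x \<in> (\<Union>n. oscillation_set g 1 p q \<inter> {- real n..real n})"
      by (intro UN_I[of n]) (auto simp: abs_le_iff)
  qed
  ultimately show ?thesis by (rule negligible_subset)
qed

text \<open>Fubini applied to (z, t) \<mapsto> z + t e: each line meets the set in a null set, so some translate
  of the set along e is null.\<close>
lemma negligible_oscillation_set:
  fixes g :: "'a::euclidean_space \<Rightarrow> real"
  assumes lip: "L-lipschitz_on UNIV g" and "p < q"
  shows "negligible (oscillation_set g e p q)"
proof -
  define N where "N = oscillation_set g e p q"
  have Nb: "N \<in> sets borel"
    unfolding N_def by (intro borel_oscillation_set lipschitz_on_continuous_on[OF lip])
  have "AE t in lborel. z + t *\<^sub>R e \<notin> N" for z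
  proof -
    define h where "h t = g (z + t *\<^sub>R e)" for t
    have "(L * norm e)-lipschitz_on UNIV h"
    proof (rule lipschitz_onI)
      fix s t :: real
      have "dist (h s) (h t) \<le> L * dist (z + s *\<^sub>R e) (z + t *\<^sub>R e)"
        unfolding h_def by (rule lipschitz_onD[OF lip]) auto
      then show "dist (h s) (h t) \<le> L * norm e * dist s t"
        by (simp add: dist_norm mult_ac real_norm_def[symmetric] flip: scaleR_diff_left del: real_norm_def)
    qed (use lipschitz_on_nonneg[OF lip] in auto)
    then have "negligible (oscillation_set h 1 p q)"
      using \<open>p < q\<close> by (rule negligible_oscillation_set_real)
    moreover have "oscillation_set h 1 p q = {t. z + t *\<^sub>R e \<in> N}"
      by (simp add: oscillation_set_def N_def h_def scaleR_add_left add_ac)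
    ultimately have "{t. z + t *\<^sub>R e \<in> N} \<in> null_sets lebesgue"
      by (simp add: negligible_iff_null_sets)
    then have "AE t in lebesgue. z + t *\<^sub>R e \<notin> N"
      by (rule AE_I') auto
    then show ?thesis by (simp add: AE_completion_iff)
  qed
  then have "AE z in lborel. AE t in lborel. z + t *\<^sub>R e \<notin> N" by simp
  \<comment> \<open>Joint measurability of the condition is what permits the exchange of the two
    almost-everywhere quantifiers.\<close>
  moreover have "{x \<in> space (lborel \<Otimes>\<^sub>M lborel). fst x + snd x *\<^sub>R e \<notin> N} \<in> sets (lborel \<Otimes>\<^sub>M lborel)"
  proof -
    have "(\<lambda>x::'a \<times> real. fst x + snd x *\<^sub>R e) \<in> borel_measurable borel"
      by (intro borel_measurable_continuous_onI continuous_intros)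
    from measurable_sets[OF this, of "- N"] Nb
    have "{x. fst x + snd x *\<^sub>R e \<notin> N} \<in> sets borel" by (simp add: vimage_def)
    moreover have "sets (lborel \<Otimes>\<^sub>M (lborel :: real measure)) = sets (borel :: ('a \<times> real) measure)"
      by (simp only: lborel_prod sets_lborel)
    ultimately show ?thesis by (simp only: space_pair_measure space_lborel space_borel UNIV_Times_UNIV UNIV_I simp_thms)
  qed
  ultimately have "AE t in lborel. AE z in lborel. z + t *\<^sub>R e \<notin> N"
    by (subst (asm) lborel_pair.AE_commute) auto
  then obtain t where t: "AE z in lborel. z + t *\<^sub>R e \<notin> N"
    using eventually_happens'[of "ae_filter (lborel :: real measure)"] by (auto simp: ae_filter_eq_bot_iff)
  have "(\<lambda>z. z + t *\<^sub>R e) \<in> borel_measurable borel"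
    by (intro borel_measurable_continuous_onI continuous_intros)
  from measurable_sets[OF this Nb] have "{z. z + t *\<^sub>R e \<in> N} \<in> sets borel"
    by (simp add: vimage_def)
  moreover have "AE z in lebesgue. z + t *\<^sub>R e \<notin> N"
    using t by (simp add: AE_completion_iff)
  ultimately have "negligible {z. z + t *\<^sub>R e \<in> N}"
    by (subst negligible_iff_null_sets, subst AE_iff_null_sets) auto
  then have "negligible ((+) (t *\<^sub>R e) ` {z. z + t *\<^sub>R e \<in> N})"
    by (rule negligible_translation)
  moreover have "N \<subseteq> (+) (t *\<^sub>R e) ` {z. z + t *\<^sub>R e \<in> N}"
  proof
    fix y assume "y \<in> N"
    then show "y \<in> (+) (t *\<^sub>R e) ` {z. z + t *\<^sub>R e \<in> N}"
      by (intro image_eqI[of _ _ "y - t *\<^sub>R e"]) auto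
  qed
  ultimately show ?thesis unfolding N_def[symmetric] by (rule negligible_subset)
qed

text \<open>If the lower limit of the quotients were below the upper one, two rationals between them
  would put \<open>x\<close> into an oscillation set. The Lipschitz bound keeps the common value
  finite.\<close>

lemma directional_derivative_exists_real:
  fixes g :: "'a::real_normed_vector \<Rightarrow> real"
  assumes lip: "L-lipschitz_on UNIV g"
    and no_osc: "\<And>p q. p \<in> \<rat> \<Longrightarrow> q \<in> \<rat> \<Longrightarrow> p < q \<Longrightarrow> x \<notin> oscillation_set g e p q"
  shows "\<exists>d. ((\<lambda>t. (g (x + t *\<^sub>R e) - g x) / t) \<longlongrightarrow> d) (at 0)"
proof -
  define Q where "Q t = (g (x + t *\<^sub>R e) - g x) / t" for t
  define l u where "l = Liminf (at 0) (\<lambda>t. ereal (Q t))" and "u = Limsup (at 0) (\<lambda>t. ereal (Q t))"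
  have bound: "\<bar>Q t\<bar> \<le> L * norm e" for t
  proof (cases "t = 0")
    case False
    have "\<bar>g (x + t *\<^sub>R e) - g x\<bar> \<le> L * (\<bar>t\<bar> * norm e)"
      using lipschitz_onD[OF lip, of "x + t *\<^sub>R e" x] by (simp add: dist_norm)
    then show ?thesis using False by (simp add: Q_def field_simps)
  qed (use lipschitz_on_nonneg[OF lip] in \<open>simp add: Q_def\<close>)
  have "l \<le> u" unfolding l_def u_def by (intro Liminf_le_Limsup) simp
  moreover have "\<not> l < u"
  proof
    assume "l < u"
    then obtain q' where q': "l < ereal q'" "ereal q' < u" using ereal_dense2 by blast
    then obtain q'' where q'': "l < ereal q''" "ereal q'' < ereal q'" using ereal_dense2 by blast
    then have "q'' < q'" by simp
    then obtain q where q: "q \<in> \<rat>" "q'' < q" "q < q'" using Rats_dense_in_real by blast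
    obtain p where p: "p \<in> \<rat>" "q'' < p" "p < q" using Rats_dense_in_real[OF q(2)] by blast
    have lp: "l < ereal p" using q''(1) p(2) by (meson ereal_less_eq(3) less_imp_le less_le_trans)
    have qu: "ereal q < u" using q'(2) q(3) by (meson ereal_less_eq(3) less_imp_le le_less_trans)
    have "\<exists>t. t \<noteq> 0 \<and> \<bar>t\<bar> < d \<and> Q t < p" if "d > 0" for d
    proof (rule ccontr)
      assume "\<nexists>t. t \<noteq> 0 \<and> \<bar>t\<bar> < d \<and> Q t < p"
      then have "eventually (\<lambda>t. ereal p \<le> ereal (Q t)) (at 0)"
        unfolding eventually_at using \<open>d > 0\<close>
        by (intro exI[of _ d]) (auto simp: dist_real_def not_less)
      then have "ereal p \<le> l" unfolding l_def by (rule Liminf_bounded)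
      with lp show False by simp
    qed
    moreover have "\<exists>t. t \<noteq> 0 \<and> \<bar>t\<bar> < d \<and> q < Q t" if "d > 0" for d
    proof (rule ccontr)
      assume "\<nexists>t. t \<noteq> 0 \<and> \<bar>t\<bar> < d \<and> q < Q t"
      then have "eventually (\<lambda>t. ereal (Q t) \<le> ereal q) (at 0)"
        unfolding eventually_at using \<open>d > 0\<close>
        by (intro exI[of _ d]) (auto simp: dist_real_def not_less)
      then have "u \<le> ereal q" unfolding u_def by (rule Limsup_bounded)
      with qu show False by simp
    qed
    ultimately have "x \<in> oscillation_set g e p q"
      unfolding oscillation_set_def Q_def by blast
    with no_osc[OF p(1) q(1) p(3)] show False by blast
  qed
  ultimately have "l = u" by simp
  then have lim: "((\<lambda>t. ereal (Q t)) \<longlongrightarrow> l) (at 0)"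
    by (simp add: tendsto_iff_Liminf_eq_Limsup l_def u_def)
  have "ereal (- (L * norm e)) \<le> l" unfolding l_def
    using bound by (intro Liminf_bounded) (simp add: abs_le_iff minus_le_iff)
  moreover have "u \<le> ereal (L * norm e)" unfolding u_def
    using bound by (intro Limsup_bounded) (simp add: abs_le_iff)
  ultimately have "\<bar>l\<bar> \<noteq> \<infinity>" using \<open>l = u\<close> by auto
  then obtain d where "l = ereal d" by auto
  with lim show ?thesis by (auto simp: Q_def)
qed

section \<open>From coordinate derivatives to Rademacher's theorem\<close>

text \<open>On \<open>A\<close> the coordinate difference quotients up to scale \<open>r\<close> are
  close to \<open>c\<close>, and non-porosity at \<open>z\<close> puts a point of \<open>A\<close>
  relatively close to every nearby point. The way from \<open>z\<close> to \<open>z + h\<close> is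
  taken one coordinate at a time. The corners of this path need not lie in \<open>A\<close>, but
  they can be exchanged for points of \<open>A\<close> at a cost controlled by the Lipschitz
  constant.\<close>

lemma differentiable_if_nonporous:
  fixes f :: "'a::euclidean_space \<Rightarrow> 'b::real_normed_vector"
  assumes lip: "L-lipschitz_on UNIV f"
    and approx: "\<And>\<kappa>. 0 < \<kappa> \<Longrightarrow> \<exists>A c r. 0 < r \<and> z \<in> A
        \<and> (\<forall>y\<in>A. \<forall>e\<in>Basis. \<forall>t. \<bar>t\<bar> < r \<longrightarrow> norm (f (y + t *\<^sub>R e) - f y - t *\<^sub>R c e) \<le> \<kappa> * \<bar>t\<bar>)
        \<and> (\<forall>e\<in>Basis. norm (c e - d e) \<le> \<kappa>)
        \<and> (\<forall>y. dist z y < r \<longrightarrow> (\<exists>w\<in>A. dist y w \<le> \<kappa> * dist z y))"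
  shows "(f has_derivative (\<lambda>h. \<Sum>e\<in>Basis. (h \<bullet> e) *\<^sub>R d e)) (at z)"
proof -
  define D where "D h = (\<Sum>e\<in>Basis. (h \<bullet> e) *\<^sub>R d e)" for h
  \<comment> \<open>Each coordinate step costs \<open>(2 * L + 2) * \<kappa> * norm h\<close>: twice
    \<open>L * \<kappa> * norm h\<close> for moving both end points, then
    \<open>\<kappa> * norm h\<close> for the estimate on \<open>A\<close> and again for replacing
    \<open>c\<close> by \<open>d\<close>.\<close>
  define K where "K = real DIM('a) * (2 * L + 2)"
  have L0: "L \<ge> 0" using lip by (rule lipschitz_on_nonneg)
  have fL: "norm (f x - f y) \<le> L * dist x y" for x y
    using lipschitz_onD[OF lip, of x y] by (simp add: dist_norm)
  have K0: "K > 0" using L0 by (simp add: K_def)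
  have "\<exists>r>0. \<forall>y. norm (y - z) < r \<longrightarrow> norm (f y - f z - D (y - z)) \<le> \<eta> * norm (y - z)"
    if "\<eta> > 0" for \<eta>
  proof -
    define \<kappa> where "\<kappa> = \<eta> / K"
    have "\<kappa> > 0" using \<open>\<eta> > 0\<close> K0 by (simp add: \<kappa>_def)
    obtain A c r where r: "0 < r" "z \<in> A"
      and A: "\<And>y e t. y \<in> A \<Longrightarrow> e \<in> Basis \<Longrightarrow> \<bar>t\<bar> < r \<Longrightarrow> norm (f (y + t *\<^sub>R e) - f y - t *\<^sub>R c e) \<le> \<kappa> * \<bar>t\<bar>"
      and c: "\<And>e. e \<in> Basis \<Longrightarrow> norm (c e - d e) \<le> \<kappa>"
      and near: "\<And>y. dist z y < r \<Longrightarrow> \<exists>w\<in>A. dist y w \<le> \<kappa> * dist z y"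
      using approx[OF \<open>\<kappa> > 0\<close>] by blast
    have "norm (f (z + h) - f z - D h) \<le> \<eta> * norm h" if h: "norm h < r" for h
    proof -
      \<comment> \<open>\<open>z + hF F\<close> are the corners of the coordinate path. Dropping
        coordinates does not increase the norm, so the corners stay in the range where
        \<open>near\<close> applies.\<close>
      define hF where "hF F = (\<Sum>e\<in>F. (h \<bullet> e) *\<^sub>R e)" for F :: "'a set"
      have hF: "norm (hF F) \<le> norm h" if "F \<subseteq> Basis" for F
      proof (rule norm_le_componentwise)
        fix b :: 'a assume "b \<in> Basis"
        have "hF F \<bullet> b = (\<Sum>e\<in>F. if e = b then h \<bullet> b else 0)"
          unfolding hF_def inner_sum_left using \<open>b \<in> Basis\<close> \<open>F \<subseteq> Basis\<close>
          by (intro sum.cong) (auto simp: inner_Basis)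
        also have "\<dots> = (if b \<in> F then h \<bullet> b else 0)"
          using finite_subset[OF \<open>F \<subseteq> Basis\<close>] by simp
        finally show "\<bar>hF F \<bullet> b\<bar> \<le> \<bar>h \<bullet> b\<bar>" by simp
      qed
      have "norm (f (z + hF F) - f z - (\<Sum>e\<in>F. (h \<bullet> e) *\<^sub>R d e)) \<le> real (card F) * ((2 * L + 2) * \<kappa> * norm h)"
        if "finite F" "F \<subseteq> Basis" for F
        using that
      proof (induction F)
        case empty
        then show ?case by (simp add: hF_def)
      next
        case (insert e F)
        define y t where "y = z + hF F" and "t = h \<bullet> e"
        have e: "e \<in> Basis" "F \<subseteq> Basis" using insert by auto
        have t: "\<bar>t\<bar> \<le> norm h" using e by (simp add: t_def Basis_le_norm)
        have zy: "dist z y \<le> norm h" using hF[OF e(2)] by (simp add: y_def dist_norm)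
        then obtain w where w: "w \<in> A" "dist y w \<le> \<kappa> * dist z y" using near[of y] h by auto
        have yw: "dist y w \<le> \<kappa> * norm h"
          using w(2) zy \<open>\<kappa> > 0\<close> by (meson less_imp_le mult_left_mono order_trans)
        have yw': "L * dist y w \<le> L * (\<kappa> * norm h)" using yw L0 by (rule mult_left_mono)
        have "f (y + t *\<^sub>R e) - f y - t *\<^sub>R d e =
            (f (y + t *\<^sub>R e) - f (w + t *\<^sub>R e)) + (f w - f y) +
            ((f (w + t *\<^sub>R e) - f w - t *\<^sub>R c e) + t *\<^sub>R (c e - d e))"
          by (simp add: algebra_simps)
        also have "norm \<dots> \<le> (L * (\<kappa> * norm h) + L * (\<kappa> * norm h)) + (\<kappa> * norm h + norm h * \<kappa>)"
        proof (intro norm_triangle_mono)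
          show "norm (f (y + t *\<^sub>R e) - f (w + t *\<^sub>R e)) \<le> L * (\<kappa> * norm h)"
            using fL[of "y + t *\<^sub>R e" "w + t *\<^sub>R e"] yw' by simp
          show "norm (f w - f y) \<le> L * (\<kappa> * norm h)"
            using fL[of w y] yw' by (simp add: dist_commute)
          have "norm (f (w + t *\<^sub>R e) - f w - t *\<^sub>R c e) \<le> \<kappa> * \<bar>t\<bar>"
            using A[OF w(1) e(1)] t h by simp
          also have "\<dots> \<le> \<kappa> * norm h" using t \<open>\<kappa> > 0\<close> by simp
          finally show "norm (f (w + t *\<^sub>R e) - f w - t *\<^sub>R c e) \<le> \<kappa> * norm h" .
          show "norm (t *\<^sub>R (c e - d e)) \<le> norm h * \<kappa>"
            using mult_mono[OF t c[OF e(1)]] by simp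
        qed
        finally have step: "norm (f (y + t *\<^sub>R e) - f y - t *\<^sub>R d e) \<le> (2 * L + 2) * \<kappa> * norm h"
          by (simp add: algebra_simps)
        have eq: "z + hF (insert e F) = y + t *\<^sub>R e"
          using insert by (simp add: hF_def y_def t_def algebra_simps)
        have "f (z + hF (insert e F)) - f z - (\<Sum>e\<in>insert e F. (h \<bullet> e) *\<^sub>R d e)
            = (f (y + t *\<^sub>R e) - f y - t *\<^sub>R d e) + (f y - f z - (\<Sum>e\<in>F. (h \<bullet> e) *\<^sub>R d e))"
          unfolding eq using insert by (simp add: t_def algebra_simps)
        also have "norm \<dots> \<le> (2 * L + 2) * \<kappa> * norm h + real (card F) * ((2 * L + 2) * \<kappa> * norm h)"
          using step insert.IH[OF e(2)] by (intro norm_triangle_mono) (simp_all add: y_def)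
        finally show ?case using insert by (simp add: algebra_simps)
      qed
      from this[of Basis] have "norm (f (z + h) - f z - D h) \<le> K * \<kappa> * norm h"
        by (simp add: hF_def euclidean_representation D_def K_def mult.assoc)
      then show ?thesis using K0 by (simp add: \<kappa>_def)
    qed
    then show ?thesis
      using r(1) by (intro exI[of _ r]) (metis add_diff_cancel_left' diff_add_cancel add.commute)
  qed
  moreover have "bounded_linear D"
    unfolding D_def by (intro bounded_linear_intros)
  ultimately have "(f has_derivative D) (at z)" by (simp add: has_derivative_at_alt)
  then show ?thesis by (simp add: D_def[abs_def])
qed

text \<open>\<open>N1\<close> contains the points lacking some coordinate derivative,
  \<open>N2\<close> the points of porosity of countably many sets \<open>A k m c\<close>. Outside
  both, and for each tolerance, \<open>z\<close> lies in some \<open>A k m c\<close> without being a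
  point of porosity of it, as \<open>differentiable_if_nonporous\<close> demands.\<close>

theorem lipschitz_negligible_nondifferentiable:
  fixes f :: "'a::euclidean_space \<Rightarrow> 'b::euclidean_space"
  assumes lip: "L-lipschitz_on UNIV f"
  shows "negligible {z. \<not> f differentiable (at z)}"
proof -
  obtain V :: "'b set" where V: "countable V" "\<And>X. open X \<Longrightarrow> X \<noteq> {} \<Longrightarrow> \<exists>v\<in>V. v \<in> X"
    using countable_dense_setE by metis
  \<comment> \<open>\<open>k\<close> fixes the tolerance, \<open>m\<close> the scale, and
    \<open>c\<close> the candidate values of the coordinate derivatives; values from the dense set
    \<open>V\<close> keep the family countable. Each set is closed, which gives the measurability
    used for porous subsets.\<close>
  define A where "A k m c = {z. \<forall>e\<in>Basis. \<forall>t. \<bar>t\<bar> < inverse (real (Suc m)) \<longrightarrow>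
      norm (f (z + t *\<^sub>R e) - f z - t *\<^sub>R c e) \<le> inverse (real (Suc k)) * \<bar>t\<bar>}" for k m :: nat and c
  define T where "T k m c = {x \<in> A k m c. \<forall>d>0. \<exists>y. y \<noteq> x \<and> dist x y < d \<and>
      ball y (inverse (real (Suc k)) * dist x y) \<inter> A k m c = {}}" for k m c
  define N1 where "N1 = (\<Union>e\<in>Basis. \<Union>b\<in>Basis. \<Union>p\<in>\<rat>. \<Union>q\<in>\<rat>\<inter>{p<..}. oscillation_set (\<lambda>z. f z \<bullet> b) e p q)"
  define N2 where "N2 = (\<Union>k. \<Union>m. \<Union>c\<in>PiE Basis (\<lambda>_. V). T k m c)"
  have lipb: "L-lipschitz_on UNIV (\<lambda>z. f z \<bullet> b)" if "b \<in> Basis" for b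
  proof (rule lipschitz_onI)
    fix x y
    have "dist (f x \<bullet> b) (f y \<bullet> b) \<le> dist (f x) (f y)"
      using Basis_le_norm[OF that, of "f x - f y"] by (simp add: dist_norm inner_diff_left)
    also have "\<dots> \<le> L * dist x y" using lipschitz_onD[OF lip] by simp
    finally show "dist (f x \<bullet> b) (f y \<bullet> b) \<le> L * dist x y" .
  qed (rule lipschitz_on_nonneg[OF lip])
  have "negligible (\<Union>p\<in>\<rat>. \<Union>q\<in>\<rat>\<inter>{p<..}. oscillation_set (\<lambda>z. f z \<bullet> b) e p q)" if "b \<in> Basis" for b e
  proof -
    have "negligible (\<Union>q\<in>\<rat>\<inter>{p<..}. oscillation_set (\<lambda>z. f z \<bullet> b) e p q)" for p
      using negligible_oscillation_set[OF lipb[OF that]]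
      by (intro negligible_countable_Union countable_image countable_Int1 countable_rat) auto
    then show ?thesis
      by (intro negligible_countable_Union countable_image countable_rat) auto
  qed
  then have "negligible (\<Union>b\<in>Basis. \<Union>p\<in>\<rat>. \<Union>q\<in>\<rat>\<inter>{p<..}. oscillation_set (\<lambda>z. f z \<bullet> b) e p q)" for e
    by (intro negligible_Union finite_imageI finite_Basis) auto
  then have "negligible N1"
    unfolding N1_def by (intro negligible_Union finite_imageI finite_Basis) auto
  have "continuous_on UNIV f" using lip by (rule lipschitz_on_continuous_on)
  then have [continuous_intros]: "continuous_on UNIV (\<lambda>z. f (z + h))" for h
    by (rule continuous_on_compose2) (auto intro!: continuous_intros)
  have "closed (A k m c)" for k m c
  proof -
    have "A k m c = (\<Inter>e\<in>Basis. \<Inter>t\<in>{t. \<bar>t\<bar> < inverse (real (Suc m))}.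
        {z. norm (f (z + t *\<^sub>R e) - f z - t *\<^sub>R c e) \<le> inverse (real (Suc k)) * \<bar>t\<bar>})"
      by (auto simp: A_def)
    also have "closed \<dots>"
      using \<open>continuous_on UNIV f\<close>
      by (intro closed_INT ballI closed_Collect_le continuous_intros)
    finally show ?thesis .
  qed
  then have "negligible (T k m c)" for k m c
    by (intro negligible_porous[of "A k m c" "inverse (real (Suc k))"]) (auto simp: T_def divide_simps)
  then have "negligible N2"
    unfolding N2_def
    by (intro negligible_countable_Union countable_image) (auto intro!: negligible_countable_Union countable_image countable_PiE V)
  have "f differentiable (at z)" if "z \<notin> N1" "z \<notin> N2" for z
  proof -
    have "\<forall>e\<in>Basis. \<exists>d. ((\<lambda>t. (f (z + t *\<^sub>R e) - f z) /\<^sub>R t) \<longlongrightarrow> d) (at 0)"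
    proof
      fix e :: 'a assume e: "e \<in> Basis"
      have "\<forall>b\<in>Basis. \<exists>d. ((\<lambda>t. (f (z + t *\<^sub>R e) \<bullet> b - f z \<bullet> b) / t) \<longlongrightarrow> d) (at 0)"
      proof (rule ballI, rule directional_derivative_exists_real[OF lipb])
        fix b :: 'b assume b: "b \<in> Basis" then show "b \<in> Basis" .
        fix p q :: real assume "p \<in> \<rat>" "q \<in> \<rat>" "p < q"
        then show "z \<notin> oscillation_set (\<lambda>z. f z \<bullet> b) e p q"
          using \<open>z \<notin> N1\<close> e b unfolding N1_def by blast
      qed
      from bchoice[OF this] obtain d
        where d: "\<forall>b\<in>Basis. ((\<lambda>t. (f (z + t *\<^sub>R e) \<bullet> b - f z \<bullet> b) / t) \<longlongrightarrow> d b) (at 0)" ..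
      have "((\<lambda>t. (f (z + t *\<^sub>R e) - f z) /\<^sub>R t) \<longlongrightarrow> (\<Sum>b\<in>Basis. d b *\<^sub>R b)) (at 0)"
        using d by (subst tendsto_componentwise_iff) (simp add: inner_diff_left divide_inverse_commute)
      then show "\<exists>d. ((\<lambda>t. (f (z + t *\<^sub>R e) - f z) /\<^sub>R t) \<longlongrightarrow> d) (at 0)" by blast
    qed
    from bchoice[OF this] obtain d
      where d: "\<forall>e\<in>Basis. ((\<lambda>t. (f (z + t *\<^sub>R e) - f z) /\<^sub>R t) \<longlongrightarrow> d e) (at 0)" ..
    have "(f has_derivative (\<lambda>h. \<Sum>e\<in>Basis. (h \<bullet> e) *\<^sub>R d e)) (at z)"
    proof (rule differentiable_if_nonporous[OF lip])
      fix \<kappa> :: real assume "0 < \<kappa>"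
      then obtain k where k: "inverse (real (Suc k)) < \<kappa>" using reals_Archimedean by blast
      define \<epsilon> where "\<epsilon> = inverse (real (Suc k))"
      have "\<epsilon> > 0" "\<epsilon> < \<kappa>" using k by (auto simp: \<epsilon>_def)
      \<comment> \<open>One half of \<open>\<epsilon>\<close> is spent on the distance from
        \<open>d\<close> to \<open>V\<close>, the other on the distance from the quotients to
        \<open>d\<close>.\<close>
      have "\<exists>v\<in>V. dist (d e) v < \<epsilon> / 2" for e
        using V(2)[of "ball (d e) (\<epsilon> / 2)"] \<open>\<epsilon> > 0\<close> by auto
      then obtain c' where c': "\<And>e. c' e \<in> V" "\<And>e. dist (d e) (c' e) < \<epsilon> / 2" by metis
      \<comment> \<open>Membership in \<open>PiE\<close> requires the default value outside
        \<open>Basis\<close>, which the restriction supplies.\<close>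
      define c where "c = restrict c' Basis"
      have c: "c \<in> PiE Basis (\<lambda>_. V)" "\<And>e. e \<in> Basis \<Longrightarrow> norm (c e - d e) < \<epsilon> / 2"
        using c' by (auto simp: c_def dist_norm norm_minus_commute)
      have "eventually (\<lambda>t. \<forall>e\<in>Basis. dist ((f (z + t *\<^sub>R e) - f z) /\<^sub>R t) (d e) < \<epsilon> / 2) (at 0)"
        using d \<open>\<epsilon> > 0\<close> by (intro eventually_ball_finite ballI tendstoD) auto
      then obtain r where r: "r > 0" "\<And>t e. t \<noteq> 0 \<Longrightarrow> \<bar>t\<bar> < r \<Longrightarrow> e \<in> Basis \<Longrightarrow>
          dist ((f (z + t *\<^sub>R e) - f z) /\<^sub>R t) (d e) < \<epsilon> / 2"
        by (auto simp: eventually_at dist_real_def)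
      obtain m where m: "inverse (real (Suc m)) < r" using reals_Archimedean[OF r(1)] by blast
      have zA: "z \<in> A k m c"
        unfolding A_def \<epsilon>_def[symmetric]
      proof (intro CollectI ballI allI impI)
        fix e :: 'a and t :: real assume e: "e \<in> Basis" and t: "\<bar>t\<bar> < inverse (real (Suc m))"
        show "norm (f (z + t *\<^sub>R e) - f z - t *\<^sub>R c e) \<le> \<epsilon> * \<bar>t\<bar>"
        proof (cases "t = 0")
          case False
          let ?q = "(f (z + t *\<^sub>R e) - f z) /\<^sub>R t"
          have "f (z + t *\<^sub>R e) - f z - t *\<^sub>R c e = t *\<^sub>R ((?q - d e) - (c e - d e))"
            using False by (simp add: algebra_simps)
          also have "norm \<dots> = \<bar>t\<bar> * norm ((?q - d e) - (c e - d e))" by simp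
          also have "\<dots> \<le> \<bar>t\<bar> * (\<epsilon> / 2 + \<epsilon> / 2)"
            using r(2)[OF False _ e] c(2)[OF e] t m
            by (intro mult_left_mono order_trans[OF norm_triangle_ineq4 add_mono]) (auto simp: dist_norm)
          finally show ?thesis by (simp add: mult.commute)
        qed simp
      qed
      moreover have "z \<notin> T k m c" using \<open>z \<notin> N2\<close> c(1) unfolding N2_def by blast
      ultimately obtain s where s: "s > 0"
        "\<And>y. y \<noteq> z \<Longrightarrow> dist z y < s \<Longrightarrow> ball y (\<epsilon> * dist z y) \<inter> A k m c \<noteq> {}"
        unfolding T_def \<epsilon>_def[symmetric] by blast
      show "\<exists>A c r. 0 < r \<and> z \<in> A
        \<and> (\<forall>y\<in>A. \<forall>e\<in>Basis. \<forall>t. \<bar>t\<bar> < r \<longrightarrow> norm (f (y + t *\<^sub>R e) - f y - t *\<^sub>R c e) \<le> \<kappa> * \<bar>t\<bar>)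
        \<and> (\<forall>e\<in>Basis. norm (c e - d e) \<le> \<kappa>)
        \<and> (\<forall>y. dist z y < r \<longrightarrow> (\<exists>w\<in>A. dist y w \<le> \<kappa> * dist z y))"
      proof (intro exI conjI)
        show "0 < min s (inverse (real (Suc m)))" using s by simp
        show "z \<in> A k m c" by fact
        show "\<forall>y\<in>A k m c. \<forall>e\<in>Basis. \<forall>t. \<bar>t\<bar> < min s (inverse (real (Suc m))) \<longrightarrow>
            norm (f (y + t *\<^sub>R e) - f y - t *\<^sub>R c e) \<le> \<kappa> * \<bar>t\<bar>"
        proof (intro ballI allI impI)
          fix y and e :: 'a and t :: real
          assume "y \<in> A k m c" "e \<in> Basis" "\<bar>t\<bar> < min s (inverse (real (Suc m)))"
          then have "norm (f (y + t *\<^sub>R e) - f y - t *\<^sub>R c e) \<le> \<epsilon> * \<bar>t\<bar>"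
            unfolding A_def \<epsilon>_def[symmetric] by auto
          also have "\<dots> \<le> \<kappa> * \<bar>t\<bar>" using \<open>\<epsilon> < \<kappa>\<close> by (intro mult_right_mono) auto
          finally show "norm (f (y + t *\<^sub>R e) - f y - t *\<^sub>R c e) \<le> \<kappa> * \<bar>t\<bar>" .
        qed
        show "\<forall>e\<in>Basis. norm (c e - d e) \<le> \<kappa>"
          using c(2) \<open>\<epsilon> < \<kappa>\<close> \<open>\<epsilon> > 0\<close> by force
        show "\<forall>y. dist z y < min s (inverse (real (Suc m))) \<longrightarrow> (\<exists>w\<in>A k m c. dist y w \<le> \<kappa> * dist z y)"
        proof (intro allI impI)
          fix y assume y: "dist z y < min s (inverse (real (Suc m)))"
          show "\<exists>w\<in>A k m c. dist y w \<le> \<kappa> * dist z y"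
          proof (cases "y = z")
            case True then show ?thesis using zA by auto
          next
            case False
            then obtain w where "w \<in> A k m c" "dist y w < \<epsilon> * dist z y" using s(2)[of y] y by auto
            moreover have "\<epsilon> * dist z y \<le> \<kappa> * dist z y"
              using \<open>\<epsilon> < \<kappa>\<close> by (intro mult_right_mono) auto
            ultimately show ?thesis by force
          qed
        qed
      qed
    qed
    then show ?thesis by (auto simp: differentiable_def)
  qed
  then have "{z. \<not> f differentiable (at z)} \<subseteq> N1 \<union> N2" by blast
  then show ?thesis using \<open>negligible N1\<close> \<open>negligible N2\<close> negligible_Un negligible_subset by blast
qed

subsection \<open>Derivatives of gradients and along sequences\<close>

text \<open>Tangent vectors arise from directions \<open>s k\<close> that vary with
  \<open>k\<close>. As these stay bounded, the remainder is still small compared with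
  \<open>t k\<close>.\<close>

lemma derivative_along_sequence:
  fixes f :: "'a::real_normed_vector \<Rightarrow> 'b::real_normed_vector"
  assumes f: "(f has_derivative D) (at z)" and t: "\<And>k. 0 < t k" "t \<longlonglongrightarrow> 0" and s: "s \<longlonglongrightarrow> w"
  shows "(\<lambda>k. (f (z + t k *\<^sub>R s k) - f z) /\<^sub>R t k) \<longlonglongrightarrow> D w"
proof -
  have bl: "bounded_linear D" using f by (rule has_derivative_bounded_linear)
  have ts: "(\<lambda>k. t k *\<^sub>R s k) \<longlonglongrightarrow> 0" using tendsto_scaleR[OF t(2) s] by simp
  have "(\<lambda>k. (f (z + t k *\<^sub>R s k) - f z - D (t k *\<^sub>R s k)) /\<^sub>R t k) \<longlonglongrightarrow> 0"
  proof (rule tendstoI)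
    fix e :: real assume "e > 0"
    \<comment> \<open>\<open>norm w + 1\<close> eventually bounds \<open>norm (s k)\<close> and is
      positive even for \<open>w = 0\<close>.\<close>
    define \<eta> where "\<eta> = e / (norm w + 1)"
    have "norm w + 1 > 0" by (smt (verit) norm_ge_zero)
    then have "\<eta> > 0" using \<open>e > 0\<close> by (simp add: \<eta>_def)
    then obtain r where r: "r > 0" "\<And>y. norm (y - z) < r \<Longrightarrow> norm (f y - f z - D (y - z)) \<le> \<eta> * norm (y - z)"
      using f unfolding has_derivative_at_alt by blast
    have "\<forall>\<^sub>F k in sequentially. dist (t k *\<^sub>R s k) 0 < r" using ts r(1) by (rule tendstoD)
    moreover have "\<forall>\<^sub>F k in sequentially. norm (s k) < norm w + 1"
      using tendsto_norm[OF s] by (rule order_tendstoD) simp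
    ultimately show "\<forall>\<^sub>F k in sequentially. dist ((f (z + t k *\<^sub>R s k) - f z - D (t k *\<^sub>R s k)) /\<^sub>R t k) 0 < e"
    proof eventually_elim
      case (elim k)
      have "norm (f (z + t k *\<^sub>R s k) - f z - D (t k *\<^sub>R s k)) \<le> \<eta> * (t k * norm (s k))"
        using r(2)[of "z + t k *\<^sub>R s k"] elim(1) t(1)[of k] by simp
      also have "\<dots> < \<eta> * (t k * (norm w + 1))"
        using elim(2) t(1)[of k] \<open>\<eta> > 0\<close> by simp
      also have "\<dots> = e * t k" using \<open>norm w + 1 > 0\<close> by (simp add: \<eta>_def)
      finally show ?case
        using t(1)[of k] by (simp add: divide_inverse_commute[symmetric] pos_divide_less_eq)
    qed
  qed
  moreover have "(\<lambda>k. D (s k)) \<longlonglongrightarrow> D w" using bounded_linear.tendsto[OF bl s] .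
  ultimately have "(\<lambda>k. (f (z + t k *\<^sub>R s k) - f z - D (t k *\<^sub>R s k)) /\<^sub>R t k + D (s k)) \<longlonglongrightarrow> 0 + D w"
    by (rule tendsto_add)
  moreover have "(f (z + t k *\<^sub>R s k) - f z - D (t k *\<^sub>R s k)) /\<^sub>R t k + D (s k) = (f (z + t k *\<^sub>R s k) - f z) /\<^sub>R t k" for k
    using t(1)[of k] by (simp add: linear_cmul[OF bounded_linear.linear[OF bl]] scaleR_diff_right)
  ultimately show ?thesis by simp
qed

text \<open>Both sides approximate the same second difference of f, which is symmetric in u and v.\<close>
lemma derivative_of_gradient_symmetric:
  fixes f :: "'a::real_inner \<Rightarrow> real" and g :: "'a \<Rightarrow> 'a"
  assumes f: "\<And>y. (f has_derivative (\<lambda>h. h \<bullet> g y)) (at y)" and g: "(g has_derivative A) (at z)"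
  shows "u \<bullet> A v = v \<bullet> A u"
proof -
  have lin: "linear A" using g has_derivative_bounded_linear bounded_linear.linear by blast
  define M where "M = norm u + norm v + 1"
  have M: "M > 0" "norm u \<le> M" "norm v \<le> M" by (auto simp: M_def add_nonneg_pos)
  have "\<bar>u \<bullet> A v - v \<bullet> A u\<bar> \<le> e" if "e > 0" for e
  proof -
    \<comment> \<open>Two second differences, each with error \<open>2 * \<eta> * t^2 * M^2\<close>,
      then err by \<open>t^2 * e\<close> together.\<close>
    define \<eta> where "\<eta> = e / (4 * M^2)"
    have "\<eta> > 0" using \<open>e > 0\<close> M by (simp add: \<eta>_def)
    then obtain r where r: "r > 0" "\<And>y. norm (y - z) < r \<Longrightarrow> norm (g y - g z - A (y - z)) \<le> \<eta> * norm (y - z)"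
      using g unfolding has_derivative_at_alt by blast
    define t where "t = r / (2 * M)"
    have t: "t > 0" "t * M < r" using r M by (auto simp: t_def)
    define \<Delta> where "\<Delta> a b = f (z + t *\<^sub>R a + t *\<^sub>R b) - f (z + t *\<^sub>R a) - f (z + t *\<^sub>R b) + f z" for a b
    have near: "\<bar>\<Delta> a b - t^2 * (b \<bullet> A a)\<bar> \<le> 2 * \<eta> * t^2 * M^2" if ab: "norm a + norm b \<le> M" for a b
    proof -
      \<comment> \<open>\<open>?x\<close> and \<open>?y\<close> run along opposite sides of a
        parallelogram in direction \<open>b\<close>. The mean value theorem for the difference of
        \<open>f\<close> on them turns \<open>\<Delta> a b\<close> into a difference of two values
        of \<open>g\<close>.\<close>
      let ?y = "\<lambda>s. z + t *\<^sub>R a + s *\<^sub>R (t *\<^sub>R b)" and ?x = "\<lambda>s. z + s *\<^sub>R (t *\<^sub>R b)"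
      have "((\<lambda>s. f (?y s) - f (?x s)) has_real_derivative (t *\<^sub>R b) \<bullet> (g (?y s) - g (?x s))) (at s)" for s
      proof -
        have "((\<lambda>s. f (?y s)) has_derivative (\<lambda>h. (h *\<^sub>R (t *\<^sub>R b)) \<bullet> g (?y s))) (at s)"
          by (rule has_derivative_compose[OF _ f]) (auto intro!: derivative_eq_intros)
        moreover have "((\<lambda>s. f (?x s)) has_derivative (\<lambda>h. (h *\<^sub>R (t *\<^sub>R b)) \<bullet> g (?x s))) (at s)"
          by (rule has_derivative_compose[OF _ f]) (auto intro!: derivative_eq_intros)
        ultimately have "((\<lambda>s. f (?y s) - f (?x s)) has_derivative
            (\<lambda>h. (h *\<^sub>R (t *\<^sub>R b)) \<bullet> g (?y s) - (h *\<^sub>R (t *\<^sub>R b)) \<bullet> g (?x s))) (at s)"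
          by (rule has_derivative_diff)
        then show ?thesis
          by (rule has_derivative_imp_has_field_derivative) (simp add: inner_diff_right algebra_simps)
      qed
      then obtain s where s: "0 < s" "s < 1"
        and "(f (?y 1) - f (?x 1)) - (f (?y 0) - f (?x 0)) = (1 - 0) * ((t *\<^sub>R b) \<bullet> (g (?y s) - g (?x s)))"
        using MVT2[of 0 1 "\<lambda>s. f (?y s) - f (?x s)" "\<lambda>s. (t *\<^sub>R b) \<bullet> (g (?y s) - g (?x s))"] by auto
      then have \<Delta>: "\<Delta> a b = t * (b \<bullet> (g (?y s) - g (?x s)))"
        by (simp add: \<Delta>_def)
      have err: "norm (g (z + h) - g z - A h) \<le> \<eta> * (t * M)" if "norm h \<le> t * M" for h
        using r(2)[of "z + h"] that t \<open>\<eta> > 0\<close> by (auto intro: order_trans[OF _ mult_left_mono])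
      have sb: "norm (s *\<^sub>R (t *\<^sub>R b)) \<le> t * norm b"
        using s t by (simp add: mult_left_le_one_le)
      have "norm (s *\<^sub>R (t *\<^sub>R b)) \<le> t * M"
        using order_trans[OF sb mult_left_mono[of "norm b" M t]] ab t norm_ge_zero[of a] by linarith
      note e1 = err[OF this]
      have "norm (t *\<^sub>R a + s *\<^sub>R (t *\<^sub>R b)) \<le> t * norm a + t * norm b"
        using sb t by (intro norm_triangle_mono) auto
      also have "\<dots> \<le> t * M" using ab t by (simp flip: distrib_left)
      finally have e2: "norm (g (?y s) - g z - A (t *\<^sub>R a + s *\<^sub>R (t *\<^sub>R b))) \<le> \<eta> * (t * M)"
        using err by (simp add: add.assoc)
      have "g (?y s) - g (?x s) - t *\<^sub>R A a
          = (g (?y s) - g z - A (t *\<^sub>R a + s *\<^sub>R (t *\<^sub>R b))) - (g (?x s) - g z - A (s *\<^sub>R (t *\<^sub>R b)))"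
        by (simp add: linear_add[OF lin] linear_cmul[OF lin])
      also have "norm \<dots> \<le> \<eta> * (t * M) + \<eta> * (t * M)"
        by (rule order_trans[OF norm_triangle_ineq4 add_mono[OF e2 e1]])
      finally have gd: "norm (g (?y s) - g (?x s) - t *\<^sub>R A a) \<le> 2 * \<eta> * t * M"
        by (simp add: mult_ac)
      have "norm b \<le> M" using ab norm_ge_zero[of a] by linarith
      have "\<Delta> a b - t^2 * (b \<bullet> A a) = t * (b \<bullet> (g (?y s) - g (?x s) - t *\<^sub>R A a))"
        by (simp add: \<Delta> inner_diff_right power2_eq_square algebra_simps)
      also have "\<bar>\<dots>\<bar> \<le> t * (norm b * norm (g (?y s) - g (?x s) - t *\<^sub>R A a))"
        using t Cauchy_Schwarz_ineq2[of b "g (?y s) - g (?x s) - t *\<^sub>R A a"] by (simp add: abs_mult)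
      also have "\<dots> \<le> t * (M * (2 * \<eta> * t * M))"
        using t M \<open>norm b \<le> M\<close> gd by (intro mult_left_mono mult_mono) auto
      finally show ?thesis by (simp add: power2_eq_square mult_ac)
    qed
    have "\<Delta> u v = \<Delta> v u" by (simp add: \<Delta>_def add_ac)
    then have "\<bar>t^2 * (u \<bullet> A v) - t^2 * (v \<bullet> A u)\<bar> \<le> 4 * \<eta> * t^2 * M^2"
      using near[of u v] near[of v u] by (auto simp: M_def)
    also have "\<dots> = t^2 * e" using M by (simp add: \<eta>_def)
    finally have "t^2 * \<bar>u \<bullet> A v - v \<bullet> A u\<bar> \<le> t^2 * e"
      by (simp add: abs_mult flip: right_diff_distrib)
    then show ?thesis using t by simp
  qed
  then have "\<bar>u \<bullet> A v - v \<bullet> A u\<bar> \<le> 0" by (rule field_le_epsilon[of _ 0, simplified])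
  then show ?thesis by simp
qed

subsection \<open>The resolvent of the subdifferential\<close>

text \<open>Where \<open>q\<close> is infinite the subgradient inequality is vacuous, so it can be
  handled by real arithmetic.\<close>

lemma subdiff_iff_real:
  assumes "proper_fun q"
  shows "s \<in> subdiff q x \<longleftrightarrow> q x < \<infinity> \<and>
    (\<forall>y. q y < \<infinity> \<longrightarrow> real_of_ereal (q x) + s \<bullet> (y - x) \<le> real_of_ereal (q y))"
proof -
  have fin: "q y < \<infinity> \<Longrightarrow> q y = ereal (real_of_ereal (q y))" for y
    using assms by (cases "q y") (auto simp: proper_fun_def)
  have "q x + ereal (s \<bullet> (y - x)) \<le> q y \<longleftrightarrow>
      (q y < \<infinity> \<longrightarrow> real_of_ereal (q x) + s \<bullet> (y - x) \<le> real_of_ereal (q y))" if "q x < \<infinity>" for y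
  proof (cases "q y < \<infinity>")
    case True
    have "q x + ereal (s \<bullet> (y - x)) = ereal (real_of_ereal (q x) + s \<bullet> (y - x))"
      by (subst fin[OF that]) simp
    then show ?thesis using fin[OF True] True by (metis ereal_less_eq(3))
  qed auto
  then show ?thesis by (auto simp: subdiff_def)
qed

text \<open>The subgradient inequalities at \<open>p\<close> and \<open>p'\<close>, each tested at
  the other point, add up to monotonicity of the subdifferential, which rearranges to this
  bound.\<close>

lemma resolvent_firmly_nonexpansive:
  assumes "proper_fun q" and p: "z - p \<in> subdiff q p" and p': "z' - p' \<in> subdiff q p'"
  shows "(norm (p - p'))\<^sup>2 \<le> (z - z') \<bullet> (p - p')"
proof -
  have "real_of_ereal (q p) + (z - p) \<bullet> (p' - p) \<le> real_of_ereal (q p')"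
    and "real_of_ereal (q p') + (z' - p') \<bullet> (p - p') \<le> real_of_ereal (q p)"
    using p p' by (auto simp: subdiff_iff_real[OF assms(1)])
  then show ?thesis
    unfolding power2_norm_eq_inner by (simp add: inner_diff_left inner_diff_right inner_commute)
qed

lemma resolvent_unique:
  assumes "proper_fun q" "z - p \<in> subdiff q p" "z - p' \<in> subdiff q p'"
  shows "p = p'"
  using resolvent_firmly_nonexpansive[OF assms] by simp

lemma lsc_eventually_greater:
  assumes "lsc_fun q" "ereal c < q p"
  shows "\<forall>\<^sub>F y in nhds p. ereal c < q y"
proof -
  have "ereal c < Liminf (at p) q" using assms by (auto simp: lsc_fun_def intro: less_le_trans)
  then have "\<forall>\<^sub>F y in at p. ereal c < q y" by (rule less_LiminfD)
  then show ?thesis using assms(2) by (simp add: eventually_nhds_conv_at)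
qed

text \<open>The point is a minimizer of q + |.-z|^2/2, which exists because the subgradient xs gives an
  affine minorant of q.\<close>
lemma resolvent_exists:
  fixes q :: "'a::euclidean_space \<Rightarrow> ereal"
  assumes q: "proper_fun q" "convex_efun q" "lsc_fun q" and xs: "xs \<in> subdiff q x"
  shows "\<exists>p. z - p \<in> subdiff q p"
proof -
  define r where "r y = real_of_ereal (q y)" for y
  define \<phi> where "\<phi> y = r y + (norm (y - z))\<^sup>2 / 2" for y
  have fin: "q y = ereal (r y)" if "q y < \<infinity>" for y
    using q(1) that by (cases "q y") (auto simp: proper_fun_def r_def)
  \<comment> \<open>Half of the quadratic term absorbs \<open>xs \<bullet> (y - z)\<close> by
    completing the square, at the price \<open>(norm xs)\<^sup>2\<close>. The other half makes
    \<open>\<phi>\<close> coercive, so minimizing sequences are bounded.\<close>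
  define b where "b = r x + xs \<bullet> (z - x) - (norm xs)\<^sup>2"
  have low: "b + (norm (y - z))\<^sup>2 / 4 \<le> \<phi> y" if "q y < \<infinity>" for y
  proof -
    have "r x + xs \<bullet> (y - x) \<le> r y"
      using xs that by (auto simp: subdiff_iff_real[OF q(1)] r_def)
    moreover have "0 \<le> ((1/2) *\<^sub>R (y - z) + xs) \<bullet> ((1/2) *\<^sub>R (y - z) + xs)" by simp
    ultimately show ?thesis
      unfolding \<phi>_def b_def power2_norm_eq_inner
      by (simp add: inner_diff_left inner_diff_right inner_add_left inner_add_right inner_commute field_simps)
  qed
  define m where "m = Inf (\<phi> ` {y. q y < \<infinity>})"
  have bdd: "bdd_below (\<phi> ` {y. q y < \<infinity>})"
  proof (rule bdd_belowI2)
    fix y assume "y \<in> {y. q y < \<infinity>}"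
    then show "b \<le> \<phi> y" using low[of y] by (simp add: order_trans[rotated])
  qed
  have ne: "{y. q y < \<infinity>} \<noteq> {}" using q(1) by (auto simp: proper_fun_def)
  have m: "m \<le> \<phi> y" if "q y < \<infinity>" for y
    unfolding m_def using bdd that by (intro cINF_lower) auto
  have "\<exists>y. q y < \<infinity> \<and> \<phi> y < m + inverse (real (Suc n))" for n
  proof -
    have "m < m + inverse (real (Suc n))" by simp
    then have "\<exists>y\<in>{y. q y < \<infinity>}. \<phi> y < m + inverse (real (Suc n))"
      unfolding m_def using cINF_less_iff[OF ne bdd] by blast
    then show ?thesis by blast
  qed
  then obtain y where y: "\<And>n. q (y n) < \<infinity>" "\<And>n. \<phi> (y n) < m + inverse (real (Suc n))" by metis
  have "norm (y n - z) \<le> sqrt (4 * (m + 1 - b))" for n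
  proof (rule real_le_rsqrt)
    have "inverse (real (Suc n)) \<le> 1" by (simp add: inverse_le_1_iff)
    then show "(norm (y n - z))\<^sup>2 \<le> 4 * (m + 1 - b)" using low[OF y(1)[of n]] y(2)[of n] by simp
  qed
  then have "bounded (range y)"
    by (intro bounded_subset[OF bounded_cball[of z "sqrt (4 * (m + 1 - b))"]])
       (auto simp: dist_norm norm_minus_commute)
  then obtain p \<rho> where \<rho>: "strict_mono \<rho>" and lim: "(\<lambda>n. y (\<rho> n)) \<longlonglongrightarrow> p"
    using bounded_imp_convergent_subsequence[of y] by (auto simp: o_def)
  \<comment> \<open>Otherwise lower semicontinuity keeps \<open>q\<close> above some larger
    \<open>c\<close> along the minimizing sequence, and the values of \<open>\<phi>\<close> could
    not tend to \<open>m\<close>.\<close>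
  have "q p \<le> ereal (m - (norm (p - z))\<^sup>2 / 2)"
  proof (rule ccontr)
    assume "\<not> ?thesis"
    then have "ereal (m - (norm (p - z))\<^sup>2 / 2) < q p" by simp
    then obtain c where c: "m - (norm (p - z))\<^sup>2 / 2 < c" "ereal c < q p"
      using ereal_dense2 by (metis ereal_less_eq(3) linorder_not_le)
    have "\<forall>\<^sub>F n in sequentially. ereal c < q (y (\<rho> n))"
      using lsc_eventually_greater[OF q(3) c(2)] lim by (rule eventually_compose_filterlim)
    then have "\<forall>\<^sub>F n in sequentially. c + (norm (y (\<rho> n) - z))\<^sup>2 / 2 \<le> m + inverse (real (Suc (\<rho> n)))"
    proof eventually_elim
      case (elim n)
      then have "c < r (y (\<rho> n))" using fin[OF y(1)] by (metis ereal_less_eq(3) linorder_not_le)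
      then show ?case using y(2)[of "\<rho> n"] by (simp add: \<phi>_def)
    qed
    moreover have "(\<lambda>n. c + (norm (y (\<rho> n) - z))\<^sup>2 / 2) \<longlonglongrightarrow> c + (norm (p - z))\<^sup>2 / 2"
      using lim by (intro tendsto_intros) auto
    moreover have "(\<lambda>n. m + inverse (real (Suc (\<rho> n)))) \<longlonglongrightarrow> m + 0"
      using LIMSEQ_subseq_LIMSEQ[OF LIMSEQ_inverse_real_of_nat \<rho>]
      by (intro tendsto_add tendsto_const) (simp add: o_def)
    ultimately have "c + (norm (p - z))\<^sup>2 / 2 \<le> m + 0"
      by (intro tendsto_le[of sequentially]) auto
    with c(1) show False by simp
  qed
  then have "q p < \<infinity>" by (auto simp: less_top[symmetric] top_ereal_def)
  moreover have pm: "r p + (norm (p - z))\<^sup>2 / 2 \<le> m"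
    using \<open>q p \<le> _\<close> fin[OF \<open>q p < \<infinity>\<close>] by simp
  moreover have "r p + (z - p) \<bullet> (w - p) \<le> r w" if w: "q w < \<infinity>" for w
  proof -
    \<comment> \<open>\<open>k\<close> is the gap in the subgradient inequality. Comparing
      \<open>p\<close> with the point at parameter \<open>u\<close> on the segment to
      \<open>w\<close> gives \<open>0 \<le> k + u * c\<close> by convexity, where
      \<open>u * c\<close> stems from the quadratic term and vanishes as \<open>u\<close> tends to
      0.\<close>
    define k where "k = r w - r p - (z - p) \<bullet> (w - p)"
    define c where "c = (norm (w - p))\<^sup>2 / 2"
    have ku: "0 \<le> k + u * c" if u: "0 < u" "u < 1" for u
    proof -
      define v where "v = u *\<^sub>R w + (1 - u) *\<^sub>R p"
      have "q v \<le> ereal u * q w + ereal (1 - u) * q p"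
        using q(2) u by (simp add: convex_efun_def v_def)
      also have "\<dots> = ereal (u * r w + (1 - u) * r p)"
        by (simp add: fin[OF w] fin[OF \<open>q p < \<infinity>\<close>])
      finally have qv: "q v \<le> ereal (u * r w + (1 - u) * r p)" .
      then have "q v < \<infinity>" by (auto simp: less_top[symmetric] top_ereal_def)
      then have rv: "r v \<le> u * r w + (1 - u) * r p" using qv fin[of v] by (metis ereal_less_eq(3))
      have vz: "v - z = (p - z) + u *\<^sub>R (w - p)" by (simp add: v_def algebra_simps)
      have "(norm (v - z))\<^sup>2 = (norm (p - z))\<^sup>2 - 2 * u * ((z - p) \<bullet> (w - p)) + u * (u * (norm (w - p))\<^sup>2)"
        unfolding vz power2_norm_eq_inner
        by (simp add: inner_diff_left inner_diff_right inner_add_left inner_add_right inner_commute algebra_simps)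
      moreover have "r p + (norm (p - z))\<^sup>2 / 2 \<le> r v + (norm (v - z))\<^sup>2 / 2"
        using pm m[OF \<open>q v < \<infinity>\<close>] by (simp add: \<phi>_def)
      ultimately have "0 \<le> u * (k + u * c)" using rv by (simp add: k_def c_def algebra_simps)
      then show ?thesis using u by (simp add: zero_le_mult_iff)
    qed
    have "((\<lambda>u. k + u * c) \<longlongrightarrow> k + 0 * c) (at_right 0)" by (intro tendsto_intros)
    moreover have "\<forall>\<^sub>F u in at_right 0. 0 \<le> k + u * c"
      using ku by (auto simp: eventually_at_right_field intro!: exI[of _ 1])
    ultimately have "0 \<le> k + 0 * c" by (rule tendsto_lowerbound) simp
    then show ?thesis by (simp add: k_def)
  qed
  ultimately show ?thesis
    by (intro exI[of _ p]) (simp add: subdiff_iff_real[OF q(1)] r_def)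
qed

section \<open>The resolvent as a map, and its derivative\<close>

text \<open>This is the proximal map of \<open>q\<close>, the inverse of the identity plus the
  subdifferential; \<open>resolvent_mem\<close> justifies the definite description.\<close>

definition resolvent :: "('a::real_inner \<Rightarrow> ereal) \<Rightarrow> 'a \<Rightarrow> 'a" where
  "resolvent q z = (THE p. z - p \<in> subdiff q p)"

context
  fixes q :: "'a::euclidean_space \<Rightarrow> ereal" and x xs :: 'a
  assumes q: "proper_fun q" "convex_efun q" "lsc_fun q" and xs: "xs \<in> subdiff q x"
begin

lemma resolvent_mem: "z - resolvent q z \<in> subdiff q (resolvent q z)"
proof -
  obtain p where p: "z - p \<in> subdiff q p" using resolvent_exists[OF q xs] by blast
  show ?thesis
    unfolding resolvent_def
    by (rule theI[where P = "\<lambda>p. z - p \<in> subdiff q p", OF p]) (rule resolvent_unique[OF q(1) _ p])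
qed

lemma resolvent_eqI: "z - p \<in> subdiff q p \<Longrightarrow> resolvent q z = p"
  using resolvent_unique[OF q(1) resolvent_mem] .

lemma resolvent_firm:
  "(norm (resolvent q z - resolvent q z'))\<^sup>2 \<le> (z - z') \<bullet> (resolvent q z - resolvent q z')"
  by (rule resolvent_firmly_nonexpansive[OF q(1) resolvent_mem resolvent_mem])

lemma resolvent_lipschitz: "1-lipschitz_on UNIV (resolvent q)"
proof (rule lipschitz_onI)
  fix z z' :: 'a
  let ?d = "norm (resolvent q z - resolvent q z')"
  have "?d * ?d \<le> norm (z - z') * ?d"
    using order_trans[OF resolvent_firm norm_cauchy_schwarz] by (simp add: power2_eq_square)
  then have "?d \<le> norm (z - z')"
    by (cases "?d = 0") (auto simp: mult_le_cancel_right)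
  then show "dist (resolvent q z) (resolvent q z') \<le> 1 * dist z z'" by (simp add: dist_norm)
qed simp

text \<open>The function is the conjugate of q + |.|^2/2, so its gradient inverts I + subdiff q.\<close>
lemma resolvent_is_gradient:
  "((\<lambda>z. z \<bullet> resolvent q z - real_of_ereal (q (resolvent q z)) - (norm (resolvent q z))\<^sup>2 / 2)
    has_derivative (\<lambda>h. h \<bullet> resolvent q z)) (at z)"
proof -
  define f where "f z = z \<bullet> resolvent q z - real_of_ereal (q (resolvent q z)) - (norm (resolvent q z))\<^sup>2 / 2" for z
  \<comment> \<open>The left-hand side is what the competitor \<open>resolvent q z\<close>
    contributes to the supremum defining the conjugate at \<open>z'\<close>. Thus
    \<open>resolvent q z\<close> is a subgradient of \<open>f\<close> at \<open>z\<close>.\<close>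
  have conj: "f z + (z' - z) \<bullet> resolvent q z \<le> f z'" for z z'
  proof -
    let ?p = "resolvent q z" and ?p' = "resolvent q z'"
    have "real_of_ereal (q ?p') + (z' - ?p') \<bullet> (?p - ?p') \<le> real_of_ereal (q ?p)"
      using resolvent_mem[of z'] resolvent_mem[of z] by (auto simp: subdiff_iff_real[OF q(1)])
    moreover have "0 \<le> (?p - ?p') \<bullet> (?p - ?p')" by simp
    ultimately show ?thesis
      unfolding f_def power2_norm_eq_inner
      by (simp add: inner_diff_left inner_diff_right inner_commute field_simps)
  qed
  \<comment> \<open>Used in both directions, \<open>conj\<close> puts the remainder between 0 and
    \<open>(y - z) \<bullet> (resolvent q y - resolvent q z)\<close>, which is quadratically small
    because the resolvent is 1-Lipschitz.\<close>
  have quad: "\<bar>f y - f z - (y - z) \<bullet> resolvent q z\<bar> \<le> norm (y - z) * norm (y - z)" for y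
  proof -
    have "(y - z) \<bullet> (resolvent q y - resolvent q z) \<le> norm (y - z) * norm (resolvent q y - resolvent q z)"
      by (rule norm_cauchy_schwarz)
    also have "\<dots> \<le> norm (y - z) * norm (y - z)"
      using lipschitz_onD[OF resolvent_lipschitz, of y z] by (intro mult_left_mono) (auto simp: dist_norm)
    finally show ?thesis
      using conj[of z y] conj[of y z] by (simp add: inner_diff_left inner_diff_right abs_le_iff)
  qed
  have "(f has_derivative (\<lambda>h. h \<bullet> resolvent q z)) (at z)"
    unfolding has_derivative_at_alt
  proof (intro conjI allI impI)
    show "bounded_linear (\<lambda>h. h \<bullet> resolvent q z)" by (rule bounded_linear_inner_left)
    fix e :: real assume "e > 0"
    show "\<exists>d>0. \<forall>y. norm (y - z) < d \<longrightarrow> norm (f y - f z - (y - z) \<bullet> resolvent q z) \<le> e * norm (y - z)"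
    proof (intro exI[of _ e] conjI allI impI)
      fix y assume "norm (y - z) < e"
      then have "norm (y - z) * norm (y - z) \<le> e * norm (y - z)" by (intro mult_right_mono) auto
      then show "norm (f y - f z - (y - z) \<bullet> resolvent q z) \<le> e * norm (y - z)"
        using quad[of y] by simp
    qed fact
  qed
  then show ?thesis by (simp add: f_def[abs_def])
qed

lemma resolvent_derivative_symmetric:
  assumes "(resolvent q has_derivative A) (at z)"
  shows "u \<bullet> A v = v \<bullet> A u"
  by (rule derivative_of_gradient_symmetric[OF resolvent_is_gradient assms])

text \<open>Firm nonexpansiveness between \<open>z\<close> and \<open>z + t n *\<^sub>R v\<close> is
  divided by \<open>t n * t n\<close> and passes to the limit.\<close>

lemma resolvent_derivative_firm:
  assumes A: "(resolvent q has_derivative A) (at z)"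
  shows "(norm (A v))\<^sup>2 \<le> v \<bullet> A v"
proof -
  define t where "t n = inverse (real (Suc n))" for n
  have t: "\<And>n. t n > 0" "t \<longlonglongrightarrow> 0"
    using LIMSEQ_inverse_real_of_nat by (auto simp: t_def[abs_def])
  let ?Q = "\<lambda>n. (resolvent q (z + t n *\<^sub>R v) - resolvent q z) /\<^sub>R t n"
  have Q: "?Q \<longlonglongrightarrow> A v" by (rule derivative_along_sequence[OF A t tendsto_const])
  have "(norm (?Q n))\<^sup>2 \<le> v \<bullet> ?Q n" for n
  proof -
    let ?d = "resolvent q (z + t n *\<^sub>R v) - resolvent q z"
    have "(norm ?d)\<^sup>2 \<le> t n * (v \<bullet> ?d)"
      using resolvent_firm[of "z + t n *\<^sub>R v" z] by simp
    then have "(norm ?d)\<^sup>2 / (t n * t n) \<le> t n * (v \<bullet> ?d) / (t n * t n)"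
      using t(1)[of n] by (intro divide_right_mono) auto
    moreover have "(norm (?Q n))\<^sup>2 = (norm ?d)\<^sup>2 / (t n * t n)"
      using t(1)[of n] by (simp add: power_mult_distrib power2_eq_square divide_inverse mult_ac)
    moreover have "v \<bullet> ?Q n = t n * (v \<bullet> ?d) / (t n * t n)"
      using t(1)[of n] by (simp add: divide_inverse)
    ultimately show ?thesis by (simp only:)
  qed
  then show ?thesis
    by (intro LIMSEQ_le[OF tendsto_power[OF tendsto_norm[OF Q]] tendsto_inner[OF tendsto_const Q]]) auto
qed

text \<open>The graph of subdiff q is parametrized by z \<mapsto> (p, z - p) with p the resolvent, so its tangent
  vectors are (A w, w - A w).\<close>
lemma regular_normal_of_resolvent_derivative:
  assumes A: "(resolvent q has_derivative A) (at z)"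
  shows "(v - A v, - A v) \<in> regular_normal_cone (graph (subdiff q)) (resolvent q z, z - resolvent q z)"
  unfolding regular_normal_cone_def
proof (intro CollectI ballI)
  fix w assume "w \<in> tangent_cone (graph (subdiff q)) (resolvent q z, z - resolvent q z)"
  then obtain t wk where t: "\<And>k. 0 < t k" "t \<longlonglongrightarrow> 0" and wk: "wk \<longlonglongrightarrow> w"
    and gr: "\<And>k. (resolvent q z, z - resolvent q z) + t k *\<^sub>R wk k \<in> graph (subdiff q)"
    unfolding tangent_cone_def by blast
  \<comment> \<open>The two components of a graph point add up to its parameter. The perturbed point
    thus has parameter \<open>z + t k *\<^sub>R s k\<close>, and its first component is the
    resolvent there.\<close>
  define s where "s k = fst (wk k) + snd (wk k)" for k
  have s: "s \<longlonglongrightarrow> fst w + snd w"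
    unfolding s_def by (intro tendsto_add tendsto_fst tendsto_snd wk)
  have "resolvent q (z + t k *\<^sub>R s k) = resolvent q z + t k *\<^sub>R fst (wk k)" for k
  proof (rule resolvent_eqI)
    have "z - resolvent q z + t k *\<^sub>R snd (wk k) \<in> subdiff q (resolvent q z + t k *\<^sub>R fst (wk k))"
      using gr[of k] by (simp add: graph_def case_prod_beta)
    moreover have "z + t k *\<^sub>R s k - (resolvent q z + t k *\<^sub>R fst (wk k)) = z - resolvent q z + t k *\<^sub>R snd (wk k)"
      by (simp add: s_def scaleR_add_right)
    ultimately show "z + t k *\<^sub>R s k - (resolvent q z + t k *\<^sub>R fst (wk k))
        \<in> subdiff q (resolvent q z + t k *\<^sub>R fst (wk k))" by (simp only:)
  qed
  then have "(\<lambda>k. (resolvent q (z + t k *\<^sub>R s k) - resolvent q z) /\<^sub>R t k) = (\<lambda>k. fst (wk k))"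
    using t(1) by (auto simp: less_imp_neq[symmetric])
  then have "(\<lambda>k. fst (wk k)) \<longlonglongrightarrow> A (fst w + snd w)"
    using derivative_along_sequence[OF A t s] by simp
  then have "fst w = A (fst w + snd w)"
    using tendsto_fst[OF wk] LIMSEQ_unique by blast
  moreover define a where "a = fst w + snd w"
  ultimately have fw: "fst w = A a" "snd w = a - A a" by (auto simp: algebra_simps)
  \<comment> \<open>By symmetry of \<open>A\<close> all terms of the pairing of
    \<open>(v - A v, - A v)\<close> with \<open>(A a, a - A a)\<close> cancel, so it is even
    0.\<close>
  have "A v \<bullet> A a = v \<bullet> A (A a)" "A v \<bullet> a = v \<bullet> A a"
    using resolvent_derivative_symmetric[OF A] by (metis inner_commute)+
  then show "(v - A v, - A v) \<bullet> w \<le> 0"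
    by (simp add: inner_prod_def fw inner_diff_left inner_diff_right)
qed

end

section \<open>Passage to the limit along points of differentiability\<close>

theorem theorem3p6:
  fixes q :: "real ^'n \<Rightarrow> ereal" and x xs :: "real ^'n"
  assumes "proper_fun q" and "convex_efun q" and "lsc_fun q"
    and "(x, xs) \<in> graph (subdiff q)"
  shows "\<exists>G :: real ^'n ^'n. psd_matrix G \<and> onorm (\<lambda>v. G *v v) \<le> 1 \<and>
           (\<forall>v. G *v v \<in> coderiv (subdiff q) (x, xs) ((mat 1 - G) *v v))"
proof -
  have xs: "xs \<in> subdiff q x" using assms(4) by (simp add: graph_def)
  note q = assms(1-3) xs
  define P where "P = resolvent q"
  have Plip: "1-lipschitz_on UNIV P" unfolding P_def by (rule resolvent_lipschitz[OF q])
  define z where "z = x + xs"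
  have Pz: "P z = x" unfolding P_def by (rule resolvent_eqI[OF q]) (simp add: z_def xs)
  \<comment> \<open>A ball is not negligible, so by Rademacher's theorem it contains a point where
    \<open>P\<close> is differentiable.\<close>
  have "\<exists>y A. dist y z < inverse (real (Suc k)) \<and> (P has_derivative A) (at y)" for k
  proof -
    have "\<not> ball z (inverse (real (Suc k))) \<subseteq> {z. \<not> P differentiable (at z)}"
      using lipschitz_negligible_nondifferentiable[OF Plip] negligible_subset open_not_negligible[OF open_ball]
      by (metis ball_eq_empty inverse_positive_iff_positive not_le of_nat_0_less_iff zero_less_Suc)
    then show ?thesis by (auto simp: differentiable_def dist_commute)
  qed
  then obtain y A where y: "\<And>k. dist (y k) z < inverse (real (Suc k))"
    and A: "\<And>k. (P has_derivative A k) (at (y k))" by metis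
  have yz: "y \<longlonglongrightarrow> z"
    unfolding tendsto_dist_iff[of y]
    by (rule tendsto_sandwich[OF _ _ tendsto_const LIMSEQ_inverse_real_of_nat])
       (intro always_eventually allI zero_le_dist less_imp_le y)+
  have sym: "u \<bullet> A k v = v \<bullet> A k u" for k u v
    using resolvent_derivative_symmetric[OF q] A unfolding P_def by blast
  have firm: "(norm (A k v))\<^sup>2 \<le> v \<bullet> A k v" for k v
    using resolvent_derivative_firm[OF q] A unfolding P_def by blast
  have lin: "linear (A k)" for k
    using A has_derivative_bounded_linear bounded_linear.linear by blast
  have nrm: "norm (A k v) \<le> norm v" for k v
  proof -
    have "norm (A k v) * norm (A k v) \<le> norm v * norm (A k v)"
      using order_trans[OF firm norm_cauchy_schwarz] by (simp add: power2_eq_square)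
    then show ?thesis by (cases "norm (A k v) = 0") (auto simp: mult_le_cancel_right)
  qed
  define M where "M k = matrix (A k)" for k
  have MA: "M k *v v = A k v" for k v
    using lin by (simp add: M_def matrix_works)
  \<comment> \<open>Entries are bounded by the operator norm, hence by 1. This crude bound on the
    matrices yields a convergent subsequence.\<close>
  have "norm (M k) \<le> real CARD('n) * real CARD('n)" for k
  proof -
    have "\<bar>M k $ i $ j\<bar> \<le> 1" for i j
    proof -
      have "onorm (A k) \<le> 1" using nrm by (intro onorm_le) simp
      then show ?thesis using component_le_onorm[OF lin, of k i j] by (simp add: M_def)
    qed
    then have "norm (M k $ i) \<le> real CARD('n)" for i
      using order_trans[OF norm_le_l1_cart sum_bounded_above[of UNIV "\<lambda>j. \<bar>M k $ i $ j\<bar>" 1]] by simp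
    then show ?thesis
      using order_trans[OF L2_set_le_sum sum_bounded_above[of UNIV "\<lambda>i. norm (M k $ i)" "real CARD('n)"]]
      by (simp add: norm_vec_def)
  qed
  then have "bounded (range M)" by (auto simp: bounded_iff)
  then obtain \<rho> B where \<rho>: "strict_mono \<rho>" and lim: "(\<lambda>k. M (\<rho> k)) \<longlonglongrightarrow> B"
    using bounded_imp_convergent_subsequence[of M] by (auto simp: o_def)
  have limv: "(\<lambda>k. A (\<rho> k) v) \<longlonglongrightarrow> B *v v" for v
    unfolding MA[symmetric] matrix_vector_mult_def
    by (intro tendsto_vec_lambda tendsto_sum tendsto_mult tendsto_vec_nth lim tendsto_const)
  have symB: "u \<bullet> (B *v v) = v \<bullet> (B *v u)" for u v
    using LIMSEQ_unique[OF tendsto_inner[OF tendsto_const limv[of v]], of u]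
      tendsto_inner[OF tendsto_const limv[of u], of v] sym[of u _ v] by simp
  have firmB: "(norm (B *v v))\<^sup>2 \<le> v \<bullet> (B *v v)" for v
    by (intro LIMSEQ_le[OF tendsto_power[OF tendsto_norm[OF limv]] tendsto_inner[OF tendsto_const limv]])
       (auto simp: firm)
  \<comment> \<open>The normals \<open>(v - A k v, - A k v)\<close> tend to
    \<open>(v - B *v v, - (B *v v))\<close> along the subsequence. Reading this as
    \<open>G *v v\<close> paired with \<open>- ((mat 1 - G) *v v)\<close> forces this
    choice.\<close>
  define G where "G = mat 1 - B"
  have G: "G *v v = v - B *v v" "(mat 1 - G) *v v = B *v v" for v
    by (simp_all add: G_def matrix_vector_mult_diff_rdistrib)
  \<comment> \<open>Expanding the square bounds \<open>2 * (v \<bullet> (B *v v))\<close> by the sum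
    of the squared norms of \<open>v\<close> and \<open>B *v v\<close>, and \<open>firmB\<close>
    absorbs the latter. Hence \<open>G\<close> has a nonnegative quadratic form.\<close>
  have "v \<bullet> (B *v v) \<le> v \<bullet> v" for v
  proof -
    have "0 \<le> (v - B *v v) \<bullet> (v - B *v v)" by simp
    then show ?thesis using firmB[of v]
      unfolding power2_norm_eq_inner by (simp add: inner_diff_left inner_diff_right inner_commute)
  qed
  moreover have "transpose G = G"
  proof -
    \<comment> \<open>Entries are values of the bilinear form of \<open>B\<close> at unit vectors,
      so \<open>symB\<close> gives symmetry of the matrix.\<close>
    have "B $ i $ j = axis i 1 \<bullet> (B *v axis j 1)" for i j
      by (simp add: inner_axis' matrix_vector_mult_basis column_def)
    then have "B $ i $ j = B $ j $ i" for i j using symB by metis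
    then show ?thesis by (simp add: G_def transpose_def vec_eq_iff mat_def)
  qed
  ultimately have psd: "psd_matrix G" by (simp add: psd_matrix_def G inner_diff_right)
  have "norm (G *v v) \<le> 1 * norm v" for v
  proof -
    \<comment> \<open>By \<open>firmB\<close> the expanded square is at most
      \<open>(norm v)\<^sup>2 - v \<bullet> (B *v v)\<close>, and the subtracted term is
      nonnegative.\<close>
    have "(norm (G *v v))\<^sup>2 \<le> (norm v)\<^sup>2"
      using firmB[of v] order_trans[OF zero_le_power2 firmB[of v]] unfolding power2_norm_eq_inner G
      by (simp add: inner_diff_left inner_diff_right inner_commute)
    then show ?thesis by (simp add: power2_le_iff_abs_le)
  qed
  then have on: "onorm (\<lambda>v. G *v v) \<le> 1" by (rule onorm_le)
  have "(G *v v, - (B *v v)) \<in> limiting_normal_cone (graph (subdiff q)) (x, xs)" for v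
  proof -
    have yr: "(\<lambda>k. y (\<rho> k)) \<longlonglongrightarrow> z"
      using LIMSEQ_subseq_LIMSEQ[OF yz \<rho>] by (simp add: o_def)
    have "isCont P z"
      using lipschitz_on_continuous_on[OF Plip] by (simp add: continuous_on_eq_continuous_at)
    then have Pr: "(\<lambda>k. P (y (\<rho> k))) \<longlonglongrightarrow> x" using isCont_tendsto_compose[OF _ yr] Pz by auto
    have "(\<lambda>k. (P (y (\<rho> k)), y (\<rho> k) - P (y (\<rho> k)))) \<longlonglongrightarrow> (x, z - x)"
      by (intro tendsto_Pair tendsto_diff Pr yr)
    moreover have "(\<lambda>k. (v - A (\<rho> k) v, - A (\<rho> k) v)) \<longlonglongrightarrow> (G *v v, - (B *v v))"
      unfolding G by (intro tendsto_Pair tendsto_diff tendsto_minus tendsto_const limv)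
    moreover have "(P (y k), y k - P (y k)) \<in> graph (subdiff q)" for k
      using resolvent_mem[OF q] by (simp add: P_def graph_def)
    moreover have "(v - A k v, - A k v) \<in> regular_normal_cone (graph (subdiff q)) (P (y k), y k - P (y k))" for k
      using regular_normal_of_resolvent_derivative[OF q] A unfolding P_def by blast
    moreover have "z - x = xs" by (simp add: z_def)
    ultimately show ?thesis unfolding limiting_normal_cone_def by (auto intro!: exI)
  qed
  then have "\<forall>v. G *v v \<in> coderiv (subdiff q) (x, xs) ((mat 1 - G) *v v)"
    by (simp add: coderiv_def G(2))
  with psd on show ?thesis by blast
qed

end
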